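(* Let $d,r,s$ be positive integers, let $b_0,\tilde b_0\in (l_0(\mathbb{Z}^d))^{r\times r}$ and $b_1,\dots,b_s,\tilde b_1,\dots,\tilde b_s\in (l_0(\mathbb{Z}^d))^{1\times r}$ be finitely supported filters and let $\mathsf M_0,\dots,\mathsf M_s$ be $d\times d$ dilation matrices. The following are equivalent: (i) $(\{b_l!\mathsf M_l\}_{l=0}^s,\{\tilde b_l!\mathsf M_l\}_{l=0}^s)$ is a biorthogonal wavelet filter bank with mixed dilation factors. (ii) $(\{b_l!\mathsf M_l\}_{l=0}^s,\{\tilde b_l!\mathsf M_l\}_{l=0}^s)$ is a dual framelet filter bank with mixed dilation factors and, for all $k,l=0,\dots,s$ and a.e. $\xi\in\mathbb{R}^d$, $$\sum_{\omega\in\Omega_k\cap\Omega_l}\widehat{b_k}(\xi+2\pi\omega)\,\overline{\widehat{\tilde b_l}(\xi+2\pi\omega)}^{\mathsf T}=\begin{cases}I_r,&k=l=0,\\ \boldsymbol\delta(k-l),&k,l\ne0,\\ 0,&k\neq0,\ l=0,\\ 0,&k=0,\ l\ne0,\end{cases}$$ where $\Omega_l:=[\mathsf M_l^{-\mathsf T}\mathbb{Z}^d]\cap[0,1)^d$.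
   Context: A $d\times d$ dilation matrix is an integer matrix all of whose eigenvalues have modulus greater than $1$. $(l(\mathbb{Z}^d))^{p\times q}$: all sequences $\mathbb{Z}^d\to\mathbb{C}^{p\times q}$; $(l_0(\mathbb{Z}^d))^{p\times q}$: finitely supported ones. $\widehat u(\xi):=\sum_{k}u(k)e^{-ik\cdot\xi}$; $\overline A^{\mathsf T}$ is the conjugate transpose; $\boldsymbol\delta(0)=1$, $\boldsymbol\delta(x)=0$ for $x\neq0$. Dual framelet filter bank with mixed dilation factors: $\sum_{l=0}^s\chi_{\Omega_l}(\omega)\overline{\widehat{b_l}(\xi)}^{\mathsf T}\widehat{\tilde b_l}(\xi+2\pi\omega)=\boldsymbol\delta(\omega)I_r$ for a.e. $\xi\in\mathbb{R}^d$ and all $\omega\in\bigcup_{l=0}^s\Omega_l$, where $\chi_E$ is the indicator function of $E$. Operators: $[\mathcal S_{a,\mathsf M}u](n):=|\det(\mathsf M)|^{1/2}\sum_{k\in\mathbb{Z}^d}u(k)a(n-\mathsf Mk)$, $[\mathcal T_{b,\mathsf M}u](n):=|\det(\mathsf M)|^{1/2}\sum_{k\in\mathbb{Z}^d}u(k)\overline{b(k-\mathsf Mn)}^{\mathsf T}$. The discrete framelet analysis operator is $\mathcal W:(l(\mathbb{Z}^d))^{1\times r}\to(l(\mathbb{Z}^d))^{1\times(s+r)}$, $\mathcal Wv=(\mathcal T_{b_1,\mathsf M_1}v,\dots,\mathcal T_{b_s,\mathsf M_s}v,\mathcal T_{b_0,\mathsf M_0}v)$, and the discrete framelet synthesis operator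 is $\tilde{\mathcal V}:(l(\mathbb{Z}^d))^{1\times(s+r)}\to(l(\mathbb{Z}^d))^{1\times r}$, $\tilde{\mathcal V}(w_1,\dots,w_s,w_0)=\sum_{l=0}^s\mathcal S_{\tilde b_l,\mathsf M_l}w_l$ ($w_1,\dots,w_s$ scalar-valued, $w_0$ $1\times r$-valued). Biorthogonal wavelet filter bank with mixed dilation factors: a dual framelet filter bank with mixed dilation factors for which one (equivalently, each) of the following holds: $\mathcal W$ is surjective; $\tilde{\mathcal V}$ is injective; $\tilde{\mathcal V}\mathcal W$ and $\mathcal W\tilde{\mathcal V}$ are the identities on $(l(\mathbb{Z}^d))^{1\times r}$ and $(l(\mathbb{Z}^d))^{1\times(s+r)}$ respectively. *)

theory Defs
  imports "HOL-Analysis.Analysis"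
begin

(* A filter with values in p-by-q matrices has type ((d, q, p) mat_filter); the types d, p, q of class
   finite index the coordinates of Z^d and the rows and columns of the values. Row vectors and
   scalars are matrices whose row (and column) index type is the one-element type 1. *)
type_synonym ('d, 'q, 'p) mat_filter = "int ^ 'd \<Rightarrow> complex ^ 'q ^ 'p"

definition finitely_supported :: "('d::finite, 'q::finite, 'p::finite) mat_filter \<Rightarrow> bool" where
  "finitely_supported u \<longleftrightarrow> finite {k. u k \<noteq> 0}"

definition real_vec :: "int ^ 'd \<Rightarrow> real ^ 'd" where
  "real_vec k = (\<chi> i. real_of_int (k $ i))"

definition conj_transpose :: "complex ^ 'q ^ 'p \<Rightarrow> complex ^ 'p ^ 'q" where
  "conj_transpose A = transpose (map_matrix cnj A)"

definition dilation_matrix :: "int ^ 'd ^ 'd \<Rightarrow> bool" where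
  "dilation_matrix M \<longleftrightarrow>
     (\<forall>c::complex. (\<exists>v. v \<noteq> 0 \<and> map_matrix of_int M *v v = c *s v) \<longrightarrow> cmod c > 1)"

definition fourier_series ::
    "('d::finite, 'q::finite, 'p::finite) mat_filter \<Rightarrow> real ^ 'd \<Rightarrow> complex ^ 'q ^ 'p" where
  "fourier_series u \<xi> =
     (\<chi> i j. \<Sum>\<^sub>\<infinity>k. u k $ i $ j * exp (- \<i> * complex_of_real (real_vec k \<bullet> \<xi>)))"

definition \<Omega> :: "int ^ 'd ^ 'd \<Rightarrow> (real ^ 'd) set" where
  "\<Omega> M = {\<omega>. (\<exists>k. \<omega> = matrix_inv (transpose (map_matrix real_of_int M)) *v real_vec k) \<and>
              (\<forall>i. 0 \<le> \<omega> $ i \<and> \<omega> $ i < 1)}"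

(* The infinite sums below have only finitely many nonzero terms when the filter a (resp. b) is
   finitely supported and M is a dilation matrix, for arbitrary u. *)
definition subdivision ::
    "('d::finite, 'r::finite, 'p::finite) mat_filter \<Rightarrow> int ^ 'd ^ 'd \<Rightarrow> ('d, 'p, 1) mat_filter \<Rightarrow> ('d, 'r, 1) mat_filter"
  where
  "subdivision a M u n =
     sqrt \<bar>real_of_int (det M)\<bar> *\<^sub>R (\<Sum>\<^sub>\<infinity>k. u k ** a (n - M *v k))"

definition transition ::
    "('d::finite, 'r::finite, 'p::finite) mat_filter \<Rightarrow> int ^ 'd ^ 'd \<Rightarrow> ('d, 'r, 1) mat_filter \<Rightarrow> ('d, 'p, 1) mat_filter"
  where
  "transition b M u n =
     sqrt \<bar>real_of_int (det M)\<bar> *\<^sub>R (\<Sum>\<^sub>\<infinity>k. u k ** conj_transpose (b (k - M *v n)))"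

(* Throughout, M0, b0, bt0 carry the index 0, and the families M, b, bt over the finite index
   type s carry the indices 1, ..., s. The tuple (w_1, ..., w_s, w_0) of coefficient sequences is
   a single sequence of row vectors indexed by the sum type s + r. *)
definition analysis ::
    "int ^ 'd ^ 'd \<Rightarrow> ('s \<Rightarrow> int ^ 'd ^ 'd) \<Rightarrow>
     ('d::finite, 'r::finite, 'r) mat_filter \<Rightarrow> ('s::finite \<Rightarrow> ('d, 'r, 1) mat_filter) \<Rightarrow>
     ('d, 'r, 1) mat_filter \<Rightarrow> ('d, 's + 'r, 1) mat_filter" where
  "analysis M0 M b0 b v n =
     (\<chi> i j. case j of
        Inl l \<Rightarrow> transition (b l) (M l) v n $ i $ 1
      | Inr m \<Rightarrow> transition b0 M0 v n $ i $ m)"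

definition synthesis ::
    "int ^ 'd ^ 'd \<Rightarrow> ('s \<Rightarrow> int ^ 'd ^ 'd) \<Rightarrow>
     ('d::finite, 'r::finite, 'r) mat_filter \<Rightarrow> ('s::finite \<Rightarrow> ('d, 'r, 1) mat_filter) \<Rightarrow>
     ('d, 's + 'r, 1) mat_filter \<Rightarrow> ('d, 'r, 1) mat_filter" where
  "synthesis M0 M bt0 bt w n =
     subdivision bt0 M0 (\<lambda>k. \<chi> i m. w k $ i $ Inr m) n +
     (\<Sum>l\<in>UNIV. subdivision (bt l) (M l) (\<lambda>k. \<chi> i j. w k $ i $ Inl l) n)"

definition dual_framelet_filter_bank ::
    "int ^ 'd ^ 'd \<Rightarrow> ('s \<Rightarrow> int ^ 'd ^ 'd) \<Rightarrow>
     ('d::finite, 'r::finite, 'r) mat_filter \<Rightarrow> ('s::finite \<Rightarrow> ('d, 'r, 1) mat_filter) \<Rightarrow>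
     ('d, 'r, 'r) mat_filter \<Rightarrow> ('s \<Rightarrow> ('d, 'r, 1) mat_filter) \<Rightarrow> bool" where
  "dual_framelet_filter_bank M0 M b0 b bt0 bt \<longleftrightarrow>
     (AE \<xi> in lborel. \<forall>\<omega> \<in> \<Omega> M0 \<union> (\<Union>l. \<Omega> (M l)).
        indicator (\<Omega> M0) \<omega> *\<^sub>R
          (conj_transpose (fourier_series b0 \<xi>) ** fourier_series bt0 (\<xi> + (2 * pi) *\<^sub>R \<omega>)) +
        (\<Sum>l\<in>UNIV. indicator (\<Omega> (M l)) \<omega> *\<^sub>R
          (conj_transpose (fourier_series (b l) \<xi>) ** fourier_series (bt l) (\<xi> + (2 * pi) *\<^sub>R \<omega>)))
        = (if \<omega> = 0 then mat 1 else 0))"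

(* For a dual framelet filter bank the three alternatives are equivalent; the definition only
   requires one of them. *)
definition biorthogonal_wavelet_filter_bank ::
    "int ^ 'd ^ 'd \<Rightarrow> ('s \<Rightarrow> int ^ 'd ^ 'd) \<Rightarrow>
     ('d::finite, 'r::finite, 'r) mat_filter \<Rightarrow> ('s::finite \<Rightarrow> ('d, 'r, 1) mat_filter) \<Rightarrow>
     ('d, 'r, 'r) mat_filter \<Rightarrow> ('s \<Rightarrow> ('d, 'r, 1) mat_filter) \<Rightarrow> bool" where
  "biorthogonal_wavelet_filter_bank M0 M b0 b bt0 bt \<longleftrightarrow>
     dual_framelet_filter_bank M0 M b0 b bt0 bt \<and>
     (let W = analysis M0 M b0 b; V = synthesis M0 M bt0 bt
      in surj W \<or> inj V \<or> (V \<circ> W = id \<and> W \<circ> V = id))"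

definition cross_sum ::
    "int ^ 'd ^ 'd \<Rightarrow> int ^ 'd ^ 'd \<Rightarrow>
     ('d::finite, 'r::finite, 'p::finite) mat_filter \<Rightarrow> ('d, 'r, 'q::finite) mat_filter \<Rightarrow>
     real ^ 'd \<Rightarrow> complex ^ 'q ^ 'p" where
  "cross_sum M N b c \<xi> =
     (\<Sum>\<omega> \<in> \<Omega> M \<inter> \<Omega> N. fourier_series b (\<xi> + (2 * pi) *\<^sub>R \<omega>) **
        conj_transpose (fourier_series c (\<xi> + (2 * pi) *\<^sub>R \<omega>)))"

end

(* The rows of all the filters can be treated alike, as scalar filters b_j with dilations M_j. For
   them W V is given by the numbers G_ij(M_i n - M_j k), where G_ij is the cross-correlation of
   b_i and tb_j, and the trigonometric polynomial with coefficients G_ij is conj(b_i^) tb_j^.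
   Averaging it over the intersection of Omega_i and Omega_j, the dual of Z^d / (M_i Z^d + M_j
   Z^d), retains precisely the coefficients on the lattice M_i Z^d + M_j Z^d, so W V = id says the
   same as the cross conditions. Likewise the dual framelet equations, summed against the
   characters of Z^d / M_j Z^d, say V W = id; once this is known, each of the three defining
   conditions of biorthogonality amounts to W V = id. Both computations need the cardinality of
   Omega_j to be |det M_j|, which is obtained by comparing the volumes of two fundamental domains
   of the lattice M_j^T Z^d. *)

theory Submission
  imports Defs
begin

section \<open>Characters and the sets \<open>\<Omega>\<close>\<close>

text \<open>Two obstacles shape the character sums. The lattice M_i Z^d + M_j Z^d comes without a
  matrix, so the intersection of two sets \<Omega> is not visibly an \<Omega> itself and the formula
  for one lattice does not apply to it. Instead, the points of \<open>\<Omega> M\<close> that also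
  lie in \<open>\<Omega> N\<close> are selected by a second average, over the D-torsion points of
  the torus with D = |det M|; by Cramer's rule this D is a common denominator of
  \<open>\<Omega> M\<close>. The other obstacle is the passage from equations for almost every \<xi>
  to coefficients. Trigonometric polynomials are continuous, so such equations hold everywhere, and
  coefficients are then read off by sampling on a grid fine enough to separate the frequencies. This
  is again a character sum over some \<open>\<Omega> (mat D)\<close>, in place of an integral. The
  cardinality of \<Omega> makes the constants agree: each operator carries a factor |det|^(1/2),
  while character sums produce cardinalities.\<close>

abbreviation real_mat :: "int ^ 'n ^ 'm \<Rightarrow> real ^ 'n ^ 'm" where
  "real_mat \<equiv> map_matrix real_of_int"

text \<open>The representative modulo Z^d in the half-open unit cube. With it, addition in the torus
  becomes an operation on the sets \<Omega>, which consist of such representatives.\<close>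

definition frac_vec :: "real ^ 'd \<Rightarrow> real ^ 'd" where
  "frac_vec x = (\<chi> i. frac (x $ i))"

definition unit_cube :: "(real ^ 'd) set" where
  "unit_cube = {x. \<forall>i. 0 \<le> x $ i \<and> x $ i < 1}"

text \<open>The exponent has the opposite sign to that in \<open>fourier_series\<close>; hence a
  frequency shift by 2 pi \<omega> will appear as the factor
  \<open>cnj (character \<omega> x)\<close>.\<close>

definition character :: "real ^ 'd::finite \<Rightarrow> int ^ 'd \<Rightarrow> complex" where
  "character \<omega> t = cis (2 * pi * (\<omega> \<bullet> real_vec t))"

lemma real_vec_nth [simp]: "real_vec k $ i = real_of_int (k $ i)"
  by (simp add: real_vec_def)

lemma real_vec_simps [simp]:
  "real_vec 0 = 0" "real_vec (k + l) = real_vec k + real_vec l"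
  "real_vec (k - l) = real_vec k - real_vec l" "real_vec (- k) = - real_vec k"
  by (simp_all add: vec_eq_iff)

lemma real_vec_eq_iff [simp]: "real_vec k = real_vec l \<longleftrightarrow> k = l"
  by (simp add: vec_eq_iff)

lemma real_vec_matrix_vector_mult: "real_vec (M *v k) = real_mat M *v real_vec k"
  by (simp add: vec_eq_iff matrix_vector_mult_def)

lemma in_range_real_vec_iff: "x \<in> range real_vec \<longleftrightarrow> (\<forall>i. x $ i \<in> \<int>)"
proof
  assume *: "\<forall>i. x $ i \<in> \<int>"
  have "x = real_vec (\<chi> i. \<lfloor>x $ i\<rfloor>)"
    using * by (simp add: vec_eq_iff)
  then show "x \<in> range real_vec" by blast
qed auto

lemma range_real_vec_add: "x \<in> range real_vec \<Longrightarrow> y \<in> range real_vec \<Longrightarrow> x + y \<in> range real_vec"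
  and range_real_vec_diff: "x \<in> range real_vec \<Longrightarrow> y \<in> range real_vec \<Longrightarrow> x - y \<in> range real_vec"
  by (simp_all add: in_range_real_vec_iff)

lemma inner_real_vec_in_Ints: "real_vec k \<bullet> real_vec l \<in> \<int>"
  by (auto simp: inner_vec_def intro!: Ints_sum Ints_mult)

lemma frac_vec_decomp: obtains k where "x = frac_vec x + real_vec k"
proof
  show "x = frac_vec x + real_vec (\<chi> i. \<lfloor>x $ i\<rfloor>)"
    by (simp add: vec_eq_iff frac_vec_def frac_def)
qed

lemma frac_vec_in_unit_cube [simp]: "frac_vec x \<in> unit_cube"
  by (simp add: unit_cube_def frac_vec_def frac_lt_1)

lemma unit_cube_cong_imp_eq:
  assumes "x \<in> unit_cube" "y \<in> unit_cube" "x - y \<in> range real_vec"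
  shows "x = y"
proof -
  have "x $ i = y $ i" for i
  proof -
    obtain z :: int where z: "x $ i - y $ i = of_int z"
      using assms(3) by (auto simp: in_range_real_vec_iff elim!: Ints_cases)
    moreover have "\<bar>x $ i - y $ i\<bar> < 1"
      using assms(1,2) unfolding unit_cube_def by (smt (verit) mem_Collect_eq)
    ultimately have "z = 0" by linarith
    with z show ?thesis by simp
  qed
  then show ?thesis by (simp add: vec_eq_iff)
qed

lemma zero_in_unit_cube [simp]: "0 \<in> unit_cube"
  by (simp add: unit_cube_def)

section \<open>Characters of the integer lattice\<close>

lemma cis_2pi_eq_1_iff: "cis (2 * pi * x) = 1 \<longleftrightarrow> x \<in> \<int>"
proof
  assume "x \<in> \<int>"
  then show "cis (2 * pi * x) = 1" by simp
next
  assume "cis (2 * pi * x) = 1"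
  then have "cos (2 * pi * x) = 1" by (metis cis.simps(1) one_complex.simps(1))
  then obtain n :: int where "2 * pi * x = of_int n * 2 * pi"
    using cos_one_2pi_int by blast
  then have "x = of_int n" by simp
  then show "x \<in> \<int>" by simp
qed

lemma character_0 [simp]: "character 0 t = 1" "character \<omega> 0 = 1"
  by (simp_all add: character_def)

lemma character_add: "character (\<omega> + \<alpha>) t = character \<omega> t * character \<alpha> t"
  "character \<omega> (t + u) = character \<omega> t * character \<omega> u"
  by (simp_all add: character_def inner_simps cis_mult distrib_left)

lemma character_uminus: "character \<omega> (- t) = cnj (character \<omega> t)"
  by (simp add: character_def cis_cnj)

lemma character_eq_1_iff: "character \<omega> t = 1 \<longleftrightarrow> \<omega> \<bullet> real_vec t \<in> \<int>"
  by (simp add: character_def cis_2pi_eq_1_iff)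

lemma character_real_vec [simp]: "character (real_vec k) t = 1"
  by (simp add: character_eq_1_iff inner_real_vec_in_Ints)

lemma character_frac_vec [simp]: "character (frac_vec x) t = character x t"
  by (metis character_add(1) character_real_vec frac_vec_decomp mult.right_neutral)

lemma inner_transpose_real_mat:
  "(transpose (real_mat M) *v \<omega>) \<bullet> real_vec k = \<omega> \<bullet> real_vec (M *v k)"
  by (simp add: real_vec_matrix_vector_mult transpose_matrix_vector dot_lmul_matrix)

lemma character_matrix_vector_mult:
  "character \<omega> (M *v k) = character (transpose (real_mat M) *v \<omega>) k"
  unfolding character_def inner_transpose_real_mat ..

section \<open>Integer matrices with nonzero determinant\<close>

lemma invertible_matrix_inv:
  assumes "invertible A"
  shows "A ** matrix_inv A = mat 1" "matrix_inv A ** A = mat 1"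
  using someI_ex[OF assms[unfolded invertible_def]] by (simp_all add: matrix_inv_def)

lemma matrix_inv_vector_mult:
  assumes "invertible A"
  shows "A *v (matrix_inv A *v x) = x" "matrix_inv A *v (A *v x) = x"
  by (simp_all add: matrix_vector_mul_assoc invertible_matrix_inv[OF assms])

lemma transpose_real_mat: "transpose (real_mat M) = real_mat (transpose M)"
  by (simp add: vec_eq_iff transpose_def)

lemma det_real_mat: "det (real_mat M) = real_of_int (det M)"
  by (simp add: det_def)

text \<open>A real kernel vector, read as a complex one, would be an eigenvector for the eigenvalue
  0.\<close>

lemma dilation_matrix_imp_det_ne_0:
  assumes "dilation_matrix M"
  shows "det M \<noteq> 0"
proof
  assume "det M = 0"
  then have "det (real_mat M) = 0" by (simp add: det_real_mat)
  then have "\<not> invertible (real_mat M)" by (simp add: invertible_det_nz)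
  then obtain x where x: "real_mat M *v x = 0" "x \<noteq> 0"
    by (metis invertible_left_inverse matrix_left_invertible_ker)
  define v :: "complex ^ 'a" where "v = (\<chi> i. of_real (x $ i))"
  have "map_matrix of_int M *v v = (\<chi> i. of_real ((real_mat M *v x) $ i))"
    by (simp add: vec_eq_iff v_def matrix_vector_mult_def)
  then have "map_matrix of_int M *v v = 0 *s v" by (simp add: x vec_eq_iff)
  moreover have "v \<noteq> 0" using x(2) by (auto simp: v_def vec_eq_iff)
  ultimately have "cmod 0 > 1" using assms unfolding dilation_matrix_def by blast
  then show False by simp
qed

lemma int_matrix_mult_inj:
  fixes M :: "int ^ 'd::finite ^ 'd"
  assumes "det M \<noteq> 0"
  shows "inj ((*v) M)"
proof (rule injI)
  fix k l assume "M *v k = M *v l"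
  then have "real_mat M *v real_vec k = real_mat M *v real_vec l"
    by (metis real_vec_matrix_vector_mult)
  moreover have "invertible (real_mat M)"
    using assms by (simp add: invertible_det_nz det_real_mat)
  ultimately show "k = l"
    by (metis matrix_inv_vector_mult(2) real_vec_eq_iff)
qed

section \<open>The sets \<Omega> as finite subgroups of the torus\<close>

lemma Omega_eq:
  assumes "det M \<noteq> 0"
  shows "\<Omega> M = {\<omega> \<in> unit_cube. transpose (real_mat M) *v \<omega> \<in> range real_vec}"
proof -
  let ?A = "transpose (real_mat M)"
  have inv: "invertible ?A"
    using assms by (simp add: invertible_det_nz det_real_mat)
  have "\<omega> = matrix_inv ?A *v x \<longleftrightarrow> ?A *v \<omega> = x" for \<omega> x
    using matrix_inv_vector_mult[OF inv] by metis
  then show ?thesis unfolding \<Omega>_def unit_cube_def by blast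
qed

text \<open>Cramer's rule: each coordinate of \<open>x\<close> is the determinant of an integer
  matrix divided by \<open>det M\<close>.\<close>

lemma det_mult_in_range_real_vec:
  assumes "det M \<noteq> 0" "real_mat M *v x \<in> range real_vec"
  shows "of_int \<bar>det M\<bar> *\<^sub>R x \<in> range real_vec"
proof -
  obtain k where k: "real_mat M *v x = real_vec k" using assms(2) by blast
  have nz: "det (real_mat M) \<noteq> 0" using assms(1) by (simp add: det_real_mat)
  have "of_int \<bar>det M\<bar> * x $ i \<in> \<int>" for i
  proof -
    let ?B = "\<chi> p j. if j = i then k $ p else M $ p $ j"
    have "x $ i = det (\<chi> p j. if j = i then real_vec k $ p else real_mat M $ p $ j) / det (real_mat M)"
      using cramer[OF nz, of x "real_vec k"] k by simp
    also have "(\<chi> p j. if j = i then real_vec k $ p else real_mat M $ p $ j) = real_mat ?B"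
      by (simp add: vec_eq_iff)
    finally have "of_int (det M) * x $ i = of_int (det ?B)"
      using assms(1) by (simp add: det_real_mat)
    then have "of_int (det M) * x $ i \<in> \<int>" by simp
    then show ?thesis by (cases "det M \<ge> 0") simp_all
  qed
  then show ?thesis by (simp add: in_range_real_vec_iff)
qed

lemma Omega_det_mult:
  assumes "det M \<noteq> 0" "\<omega> \<in> \<Omega> M"
  shows "of_int \<bar>det M\<bar> *\<^sub>R \<omega> \<in> range real_vec"
proof -
  have "det (transpose M) \<noteq> 0" using assms by simp
  moreover have "real_mat (transpose M) *v \<omega> \<in> range real_vec"
    using assms(2) by (simp add: Omega_eq[OF assms(1)] flip: transpose_real_mat)
  ultimately have "of_int \<bar>det (transpose M)\<bar> *\<^sub>R \<omega> \<in> range real_vec"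
    by (rule det_mult_in_range_real_vec)
  then show ?thesis by simp
qed

lemma finite_int_vec_box: "finite {k :: int ^ 'd::finite. \<forall>i. k $ i \<in> A}" if "finite A"
proof -
  have "finite (Pi\<^sub>E (UNIV :: 'd set) (\<lambda>_. A))"
    using that by (simp add: finite_PiE)
  then have "finite (vec_lambda ` Pi\<^sub>E (UNIV :: 'd set) (\<lambda>_. A))" by simp
  moreover have "{k :: int ^ 'd. \<forall>i. k $ i \<in> A} \<subseteq> vec_lambda ` Pi\<^sub>E (UNIV :: 'd set) (\<lambda>_. A)"
    by (auto intro!: image_eqI[where x = "vec_nth _"])
  ultimately show ?thesis by (rule rev_finite_subset)
qed

text \<open>The points have the common denominator |det M| and lie in the unit cube, so their
  numerators lie in a finite box.\<close>

lemma finite_Omega: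
  assumes "det M \<noteq> 0"
  shows "finite (\<Omega> M)"
proof -
  define D where "D = \<bar>det M\<bar>"
  have D: "D > 0" using assms by (simp add: D_def)
  have "\<Omega> M \<subseteq> (\<lambda>k. (1 / of_int D) *\<^sub>R real_vec k) ` {k. \<forall>i. k $ i \<in> {0..<D}}"
  proof
    fix \<omega> assume \<omega>: "\<omega> \<in> \<Omega> M"
    obtain k where k: "of_int D *\<^sub>R \<omega> = real_vec k"
      using Omega_det_mult[OF assms \<omega>] by (auto simp: D_def)
    have "k $ i \<in> {0..<D}" for i
    proof -
      have ki: "of_int (k $ i) = of_int D * \<omega> $ i"
        using arg_cong[OF k, of "\<lambda>v. v $ i"] by simp
      have "0 \<le> \<omega> $ i" "\<omega> $ i < 1"
        using \<omega> Omega_eq[OF assms] by (auto simp: unit_cube_def)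
      then have "0 \<le> real_of_int (k $ i)" "real_of_int (k $ i) < of_int D"
        using D by (auto simp: ki)
      then show ?thesis by simp
    qed
    moreover have "\<omega> = (1 / of_int D) *\<^sub>R real_vec k"
      using D by (simp flip: k)
    ultimately show "\<omega> \<in> (\<lambda>k. (1 / of_int D) *\<^sub>R real_vec k) ` {k. \<forall>i. k $ i \<in> {0..<D}}" by blast
  qed
  then show ?thesis by (rule finite_subset) (intro finite_imageI finite_int_vec_box, simp)
qed

lemma zero_in_Omega: "det M \<noteq> 0 \<Longrightarrow> 0 \<in> \<Omega> M"
  by (auto simp: Omega_eq in_range_real_vec_iff)

lemma frac_vec_in_Omega:
  assumes "det M \<noteq> 0" "transpose (real_mat M) *v x \<in> range real_vec"
  shows "frac_vec x \<in> \<Omega> M"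
proof -
  obtain k where k: "x = frac_vec x + real_vec k" by (rule frac_vec_decomp)
  have "transpose (real_mat M) *v frac_vec x
      = transpose (real_mat M) *v x - transpose (real_mat M) *v real_vec k"
    by (subst (2) k) (simp add: matrix_vector_right_distrib)
  moreover have "transpose (real_mat M) *v real_vec k \<in> range real_vec"
    by (simp add: transpose_real_mat flip: real_vec_matrix_vector_mult)
  ultimately show ?thesis
    using assms by (simp add: Omega_eq range_real_vec_diff)
qed

text \<open>The \<open>\<Omega>\<close>-sets represent subgroups of the torus, so translating by an element of one of
  them only permutes the sum, multiplying it by the value of the character.\<close>

lemma sum_character_translation:
  assumes fin: "finite G" and G: "G \<subseteq> unit_cube"
    and closed: "\<And>\<omega>. \<omega> \<in> G \<Longrightarrow> frac_vec (\<omega> + \<alpha>) \<in> G" and ne: "character \<alpha> t \<noteq> 1"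
  shows "(\<Sum>\<omega>\<in>G. character \<omega> t) = 0"
proof -
  let ?\<tau> = "\<lambda>\<omega>. frac_vec (\<omega> + \<alpha>)"
  have inj: "inj_on ?\<tau> G"
  proof (rule inj_onI)
    fix x y assume xy: "x \<in> G" "y \<in> G" "?\<tau> x = ?\<tau> y"
    obtain k l where "x + \<alpha> = ?\<tau> x + real_vec k" "y + \<alpha> = ?\<tau> y + real_vec l"
      by (metis frac_vec_decomp)
    then have "x - y = real_vec (k - l)" unfolding xy(3) real_vec_simps by (metis add_diff_cancel_left add_diff_cancel_right)
    then show "x = y" using xy G by (blast intro: unit_cube_cong_imp_eq)
  qed
  have "?\<tau> ` G = G"
    using closed fin inj by (intro endo_inj_surj) auto
  then have "(\<Sum>\<omega>\<in>G. character \<omega> t) = (\<Sum>\<omega>\<in>G. character (?\<tau> \<omega>) t)"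
    using sum.reindex[OF inj, of "\<lambda>\<omega>. character \<omega> t"] by simp
  also have "\<dots> = character \<alpha> t * (\<Sum>\<omega>\<in>G. character \<omega> t)"
    by (simp add: character_add sum_distrib_left mult.commute)
  finally show ?thesis using ne by (simp add: algebra_simps)
qed

lemma sum_character_Omega_eq_0:
  assumes M: "det M \<noteq> 0" and t: "t \<notin> range ((*v) M)"
  shows "(\<Sum>\<omega>\<in>\<Omega> M. character \<omega> t) = 0"
proof -
  let ?A = "real_mat M"
  have inv: "invertible ?A" using M by (simp add: invertible_det_nz det_real_mat)
  define y where "y = matrix_inv ?A *v real_vec t"
  have y: "?A *v y = real_vec t"
    unfolding y_def by (rule matrix_inv_vector_mult(1)[OF inv])
  have "y \<notin> range real_vec"
  proof
    assume "y \<in> range real_vec"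
    then obtain l where "y = real_vec l" by blast
    then have "real_vec (M *v l) = real_vec t" by (metis real_vec_matrix_vector_mult y)
    then show False using t by auto
  qed
  then obtain i where i: "y $ i \<notin> \<int>" by (auto simp: in_range_real_vec_iff)
  \<comment> \<open>Chosen so that its inner product with \<open>t\<close> is the non-integral
    coordinate \<open>y $ i\<close>, while the transpose of M maps it into Z^d; translation by it
    therefore preserves \<open>\<Omega> M\<close> but changes the character.\<close>
  define \<alpha> where "\<alpha> = matrix_inv (transpose ?A) *v real_vec (axis i 1)"
  have \<alpha>: "transpose ?A *v \<alpha> = real_vec (axis i 1)"
    unfolding \<alpha>_def by (rule matrix_inv_vector_mult(1)[OF transpose_invertible[OF inv]])
  have "\<alpha> \<bullet> real_vec t = (transpose ?A *v \<alpha>) \<bullet> y"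
    by (simp add: y[symmetric] transpose_matrix_vector dot_lmul_matrix)
  also have "\<dots> = y $ i"
    unfolding \<alpha> by (simp add: inner_vec_def axis_def if_distrib[of real_of_int] if_distrib[of "\<lambda>x. x * _"] cong: if_cong)
  finally have ne: "character \<alpha> t \<noteq> 1" using i by (simp add: character_eq_1_iff)
  show ?thesis
  proof (rule sum_character_translation[OF _ _ _ ne])
    show "frac_vec (\<omega> + \<alpha>) \<in> \<Omega> M" if "\<omega> \<in> \<Omega> M" for \<omega>
    proof (rule frac_vec_in_Omega[OF M])
      show "transpose ?A *v (\<omega> + \<alpha>) \<in> range real_vec"
        unfolding matrix_vector_right_distrib \<alpha>
        using that Omega_eq[OF M] by (intro range_real_vec_add) auto
    qed
  qed (use M finite_Omega Omega_eq in auto)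
qed

lemma character_Omega_lattice:
  assumes "det M \<noteq> 0" "\<omega> \<in> \<Omega> M"
  shows "character \<omega> (M *v k) = 1"
  using assms by (auto simp: character_matrix_vector_mult Omega_eq)

lemma sum_character_Omega:
  assumes "det M \<noteq> 0"
  shows "(\<Sum>\<omega>\<in>\<Omega> M. character \<omega> t) = (if t \<in> range ((*v) M) then of_nat (card (\<Omega> M)) else 0)"
  using sum_character_Omega_eq_0[OF assms] character_Omega_lattice[OF assms] by auto

lemma det_mat_of_int [simp]: "det (mat c :: 'a::comm_ring_1 ^ 'n::finite ^ 'n) = c ^ CARD('n)"
  by (simp add: det_diagonal mat_def)

lemma mat_vector_mult [simp]: "mat c *v (k :: 'a::comm_ring_1 ^ 'n::finite) = (\<chi> i. c * k $ i)"
  by (simp add: vec_eq_iff matrix_vector_mult_def mat_def if_distrib[of "\<lambda>x. x * _"] cong: if_cong)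

text \<open>An integrality test for \<eta> = k/D: the D-torsion points of the torus detect whether
  \<open>k\<close> is divisible by D.\<close>

lemma sum_character_mult_inner:
  fixes \<eta> :: "real ^ 'd::finite"
  assumes "D > 0" "of_int D *\<^sub>R \<eta> = real_vec k"
  shows "(\<Sum>m\<in>\<Omega> (mat D). character m k) =
    (if \<eta> \<in> range real_vec then of_nat (card (\<Omega> (mat D :: int ^ 'd ^ 'd))) else 0)"
proof -
  have "k \<in> range ((*v) (mat D)) \<longleftrightarrow> \<eta> \<in> range real_vec"
  proof -
    have "k = mat D *v l \<longleftrightarrow> \<eta> = real_vec l" for l
    proof -
      have "k = mat D *v l \<longleftrightarrow> of_int D *\<^sub>R \<eta> = of_int D *\<^sub>R real_vec l"
        unfolding assms(2) by (simp add: vec_eq_iff flip: of_int_mult)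
      then show ?thesis using assms(1) by simp
    qed
    then show ?thesis by blast
  qed
  then show ?thesis using sum_character_Omega[of "mat D" k] assms(1) by simp
qed

text \<open>Fourier inversion on the dual of \<open>\<int>\<^sup>d/M\<int>\<^sup>d\<close>: summing over the translates of \<open>t\<close> by
  \<open>N\<int>\<^sup>d\<close> projects onto the characters that are trivial on \<open>N\<int>\<^sup>d\<close>.\<close>

lemma sum_character_Omega_Int_eq_0:
  fixes M N :: "int ^ 'd::finite ^ 'd"
  assumes M: "det M \<noteq> 0" and N: "det N \<noteq> 0" and t: "\<And>m n. t \<noteq> M *v m - N *v n"
  shows "(\<Sum>\<omega>\<in>\<Omega> M \<inter> \<Omega> N. character \<omega> t) = 0"
proof -
  define D where "D = \<bar>det M\<bar>"
  have D: "D > 0" using M by (simp add: D_def)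
  \<comment> \<open>The D-torsion points. For \<open>m\<close> in \<open>E\<close> the integer
    vectors \<open>K m\<close> = D m represent Z^d / D Z^d, so the vectors
    \<open>t + N *v K m\<close> used below are enough translates of \<open>t\<close> to test
    triviality on N Z^d.\<close>
  define E where "E = \<Omega> (mat D :: int ^ 'd ^ 'd)"
  have E: "finite E" "card E > 0"
    unfolding E_def using D finite_Omega[of "mat D :: int ^ 'd ^ 'd"] zero_in_Omega[of "mat D :: int ^ 'd ^ 'd"]
    by (auto simp: card_gt_0_iff)
  have "\<exists>k. of_int D *\<^sub>R m = real_vec k" if "m \<in> E" for m
  proof -
    have "transpose (real_mat (mat D :: int ^ 'd ^ 'd)) *v m \<in> range real_vec"
      using that D by (simp add: E_def Omega_eq)
    moreover have "transpose (real_mat (mat D :: int ^ 'd ^ 'd)) = mat (of_int D)"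
      by (simp add: vec_eq_iff mat_def transpose_def)
    ultimately show ?thesis by (simp add: scaleR_vec_def image_iff)
  qed
  then obtain K where K: "\<And>m. m \<in> E \<Longrightarrow> of_int D *\<^sub>R m = real_vec (K m)" by metis
  have "\<exists>k. of_int D *\<^sub>R (transpose (real_mat N) *v \<omega>) = real_vec k" if "\<omega> \<in> \<Omega> M" for \<omega>
  proof -
    obtain k where k: "of_int D *\<^sub>R \<omega> = real_vec k"
      using Omega_det_mult[OF M \<open>\<omega> \<in> \<Omega> M\<close>] unfolding D_def by blast
    have "of_int D *\<^sub>R (transpose (real_mat N) *v \<omega>) = transpose (real_mat N) *v (of_int D *\<^sub>R \<omega>)"
      by (simp add: matrix_vector_mult_scaleR)
    then show ?thesis
      by (metis k transpose_real_mat real_vec_matrix_vector_mult)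
  qed
  then obtain L where L: "\<And>\<omega>. \<omega> \<in> \<Omega> M \<Longrightarrow> of_int D *\<^sub>R (transpose (real_mat N) *v \<omega>) = real_vec (L \<omega>)"
    by metis
  \<comment> \<open>Reciprocity: both phases are the inner product of \<omega> with N (D m), where
    the factor D can be moved from \<open>m\<close> to the transpose of N applied to \<omega>. As a
    function of \<open>m\<close> the value is thus a character with an integer argument.\<close>
  have swap: "character \<omega> (N *v K m) = character m (L \<omega>)" if "m \<in> E" "\<omega> \<in> \<Omega> M" for m \<omega>
  proof -
    have "\<omega> \<bullet> real_vec (N *v K m) = (transpose (real_mat N) *v \<omega>) \<bullet> (of_int D *\<^sub>R m)"
      unfolding K[OF that(1)] inner_transpose_real_mat ..
    also have "\<dots> = m \<bullet> (of_int D *\<^sub>R (transpose (real_mat N) *v \<omega>))"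
      by (simp add: inner_commute)
    finally show ?thesis by (simp only: character_def L[OF that(2)])
  qed
  \<comment> \<open>No translate of \<open>t\<close> by N Z^d meets the lattice of M, so every inner
    sum vanishes; summing over \<open>m\<close> first leaves only those \<omega> that also lie in
    \<open>\<Omega> N\<close>.\<close>
  have "0 = (\<Sum>m\<in>E. \<Sum>\<omega>\<in>\<Omega> M. character \<omega> (t + N *v K m))"
  proof (rule sum.neutral[symmetric], rule ballI, rule sum_character_Omega_eq_0[OF M])
    fix m
    show "t + N *v K m \<notin> range ((*v) M)"
      using t by (metis add_diff_cancel_right' image_iff)
  qed
  also have "\<dots> = (\<Sum>\<omega>\<in>\<Omega> M. character \<omega> t * (\<Sum>m\<in>E. character m (L \<omega>)))"
    by (subst sum.swap) (simp add: character_add sum_distrib_left swap)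
  also have "\<dots> = (\<Sum>\<omega>\<in>\<Omega> M. if transpose (real_mat N) *v \<omega> \<in> range real_vec
      then of_nat (card E) * character \<omega> t else 0)"
    using sum_character_mult_inner[OF D L] by (intro sum.cong) (auto simp: E_def)
  also have "\<dots> = of_nat (card E) * (\<Sum>\<omega>\<in>\<Omega> M \<inter> \<Omega> N. character \<omega> t)"
  proof -
    have "\<Omega> M \<inter> {\<omega>. transpose (real_mat N) *v \<omega> \<in> range real_vec} = \<Omega> M \<inter> \<Omega> N"
      using M N by (auto simp: Omega_eq)
    then show ?thesis by (simp add: sum.If_cases finite_Omega M sum_distrib_left)
  qed
  finally show ?thesis using E by auto
qed

lemma sum_character_Omega_Int:
  assumes M: "det M \<noteq> 0" and N: "det N \<noteq> 0"
  shows "(\<Sum>\<omega>\<in>\<Omega> M \<inter> \<Omega> N. character \<omega> t) =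
    (if \<exists>m n. t = M *v m - N *v n then of_nat (card (\<Omega> M \<inter> \<Omega> N)) else 0)"
proof (cases "\<exists>m n. t = M *v m - N *v n")
  case True
  then obtain m n where t: "t = M *v m + - (N *v n)" by (metis diff_conv_add_uminus)
  have "character \<omega> t = 1" if "\<omega> \<in> \<Omega> M \<inter> \<Omega> N" for \<omega>
    unfolding t character_add(2) character_uminus using that by (simp add: character_Omega_lattice M N)
  then show ?thesis using True by simp
qed (use sum_character_Omega_Int_eq_0[OF M N, of t] in simp)

section \<open>The cardinality of \<open>\<Omega>\<close>\<close>

text \<open>The library has this only for index types of class \<open>wellorder\<close>, because it evaluates the
  determinant of a shear as that of a triangular matrix; here the shear is a row operation on the
  identity.\<close>

lemma measure_matrix_image:
  fixes A :: "real ^ 'n::finite ^ 'n"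
  assumes "S \<in> lmeasurable"
  shows "(*v) A ` S \<in> lmeasurable \<and> measure lebesgue ((*v) A ` S) = \<bar>det A\<bar> * measure lebesgue S"
proof -
  define P where "P = (\<lambda>A :: real ^ 'n ^ 'n. \<forall>S\<in>lmeasurable. (*v) A ` S \<in> lmeasurable \<and>
    measure lebesgue ((*v) A ` S) = \<bar>det A\<bar> * measure lebesgue S)"
  \<comment> \<open>For determinant of modulus 1 it is enough to test boxes; the coordinate swap and
    the shear below are handled this way.\<close>
  have boxes: "P B" if "\<bar>det B\<bar> = 1"
    "\<And>a b. cbox a b \<noteq> {} \<Longrightarrow> measure lebesgue ((*v) B ` cbox a b) = measure lebesgue (cbox a b)" for B
  proof -
    have im: "measure lebesgue ((*v) B ` cbox a b) = \<bar>det B\<bar> * measure lebesgue (cbox a b)" for a b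
      using that by (cases "cbox a b = {}") auto
    show ?thesis
      unfolding P_def using measure_linear_sufficient[OF matrix_vector_mul_linear _ im] by auto
  qed
  have "P A"
  proof (rule induct_matrix_elementary_alt)
    show "P (B ** C)" if "P B" "P C" for B C
    proof -
      have "(*v) (B ** C) ` T = (*v) B ` (*v) C ` T" for T
        by (simp add: image_image flip: matrix_vector_mul_assoc)
      then show ?thesis using that by (simp add: P_def det_mul abs_mult)
    qed
  next
    fix B :: "real ^ 'n ^ 'n" and i
    assume "row i B = 0"
    then have "det B = 0" by (simp add: det_zero_row)
    then have "\<not> inj ((*v) B)" 
      using det_nz_iff_inj[OF matrix_vector_mul_linear, of B] by simp
    then have "negligible ((*v) B ` T)" for T
      by (intro negligible_linear_singular_image) auto
    then show "P B"
      using \<open>det B = 0\<close> by (simp add: P_def negligible_iff_measure)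
  next
    fix B :: "real ^ 'n ^ 'n"
    assume diag: "\<And>i j. i \<noteq> j \<Longrightarrow> B $ i $ j = 0"
    have "(\<Sum>j\<in>UNIV. B $ i $ j * x $ j) = B $ i $ i * x $ i" for i x
      by (subst sum.remove[of _ i]) (auto simp: diag intro!: sum.neutral)
    then have "(*v) B = (\<lambda>x. \<chi> k. B $ k $ k * x $ k)"
      by (simp add: fun_eq_iff matrix_vector_mult_def vec_eq_iff)
    then show "P B"
      by (simp add: P_def measurable_stretch measure_stretch det_diagonal diag)
  next
    fix m n :: 'n
    assume "m \<noteq> n"
    let ?t = "Transposition.transpose m n" and ?B = "(\<chi> i j. mat 1 $ i $ Transposition.transpose m n j) :: real ^ 'n ^ 'n"
    have B: "?B *v x = (\<chi> i. x $ ?t i)" for x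
    proof -
      have "(\<Sum>j\<in>UNIV. (mat 1 :: real ^ 'n ^ 'n) $ i $ ?t j * x $ j) = x $ ?t i" for i
      proof -
        have "(\<Sum>j\<in>UNIV. (mat 1 :: real ^ 'n ^ 'n) $ i $ ?t j * x $ j) = (\<Sum>j\<in>UNIV. if j = ?t i then x $ j else 0)"
          by (intro sum.cong) (auto simp: mat_def)
        then show ?thesis by simp
      qed
      then show ?thesis by (simp add: matrix_vector_mult_def vec_eq_iff)
    qed
    show "P ?B"
    proof (rule boxes)
      show "\<bar>det ?B\<bar> = 1"
        using \<open>m \<noteq> n\<close> by (simp add: det_permute_columns permutes_swap_id sign_swap_id)
      fix a b :: "real ^ 'n"
      assume ne: "cbox a b \<noteq> {}"
      have "(*v) ?B ` cbox a b = cbox (?B *v a) (?B *v b)"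
      proof (intro set_eqI iffI)
        fix y assume "y \<in> cbox (?B *v a) (?B *v b)"
        then have *: "?B *v y \<in> cbox a b"
          unfolding B mem_box_cart by simp (metis transpose_involutory)
        have "?B *v (?B *v y) = y" unfolding B by (simp add: vec_eq_iff)
        then show "y \<in> (*v) ?B ` cbox a b" by (rule image_eqI[OF sym *])
      qed (auto simp: B mem_box_cart)
      moreover from this ne have "cbox (?B *v a) (?B *v b) \<noteq> {}" by auto
      moreover have "(\<Prod>i\<in>UNIV. (?B *v b) $ i - (?B *v a) $ i) = (\<Prod>i\<in>UNIV. b $ i - a $ i)"
        unfolding B
        using prod.permute[OF permutes_swap_id[of m UNIV n], where g = "\<lambda>i. b $ i - a $ i"]
        by (simp add: o_def)
      ultimately show "measure lebesgue ((*v) ?B ` cbox a b) = measure lebesgue (cbox a b)"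
        using ne by (simp add: content_cbox_cart)
    qed
  next
    fix m n :: 'n
    assume mn: "m \<noteq> n"
    let ?B = "(\<chi> i j. of_bool (i = m \<and> j = n \<or> i = j)) :: real ^ 'n ^ 'n"
    have B: "?B *v x = (\<chi> i. if i = m then x $ m + x $ n else x $ i)" for x
    proof -
      have "(\<Sum>j\<in>UNIV. of_bool (i = m \<and> j = n \<or> i = j) * x $ j) = (if i = m then x $ m + x $ n else x $ i)" for i
      proof -
        have "(\<Sum>j\<in>UNIV. of_bool (i = m \<and> j = n \<or> i = j) * x $ j)
          = (\<Sum>j\<in>UNIV. (if j = n then if i = m then x $ j else 0 else 0) + (if j = i then x $ j else 0))"
          using mn by (intro sum.cong) auto
        also have "\<dots> = (if i = m then x $ m + x $ n else x $ i)"
          by (simp add: sum.distrib)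
        finally show ?thesis .
      qed
      then show ?thesis by (simp add: matrix_vector_mult_def vec_eq_iff)
    qed
    show "P ?B"
    proof (rule boxes)
      have "?B = (\<chi> k. if k = m then row m (mat 1) + 1 *s row n (mat 1) else row k (mat 1))"
        using mn by (auto simp: vec_eq_iff row_def mat_def)
      then show "\<bar>det ?B\<bar> = 1" using det_row_operation[OF mn, of "mat 1 :: real ^ 'n ^ 'n" 1] by simp
      fix a b :: "real ^ 'n"
      assume ne: "cbox a b \<noteq> {}"
      \<comment> \<open>\<open>measure_shear_interval\<close> asks for a lower corner with
        nonnegative coordinate \<open>n\<close>; translating by \<open>- v\<close> makes that
        coordinate 0.\<close>
      define v where "v = axis n (a $ n)"
      have a: "a = v + (a - v)" and b: "b = v + (b - v)" by simp_all
      have "cbox a b = (+) v ` cbox (a - v) (b - v)"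
        by (metis a b cbox_translation)
      then have "(*v) ?B ` cbox a b = (+) (?B *v v) ` (*v) ?B ` cbox (a - v) (b - v)"
        by (simp add: image_image matrix_vector_right_distrib)
      then have "measure lebesgue ((*v) ?B ` cbox a b) = measure lebesgue ((*v) ?B ` cbox (a - v) (b - v))"
        by (simp add: measure_translation)
      also have "\<dots> = measure lebesgue (cbox (a - v) (b - v))"
        unfolding B using ne \<open>cbox a b = _\<close> by (intro measure_shear_interval[OF mn]) (auto simp: v_def)
      also have "\<dots> = measure lebesgue (cbox a b)"
        unfolding \<open>cbox a b = _\<close> by (simp add: measure_translation)
      finally show "measure lebesgue ((*v) ?B ` cbox a b) = measure lebesgue (cbox a b)" .
    qed
  qed
  then show ?thesis using assms unfolding P_def by blast
qed

section \<open>Fundamental domains and their volumes\<close>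

lemma unit_cube_cong: "\<exists>!k. x - real_vec k \<in> unit_cube"
proof -
  obtain k where "x = frac_vec x + real_vec k" by (rule frac_vec_decomp)
  then have k: "x - real_vec k \<in> unit_cube" by (metis add_diff_cancel_right' frac_vec_in_unit_cube)
  moreover have "l = k" if "x - real_vec l \<in> unit_cube" for l
  proof -
    have "x - real_vec l - (x - real_vec k) = real_vec (k - l)" by simp
    then have "x - real_vec l = x - real_vec k"
      using that k by (intro unit_cube_cong_imp_eq) (auto simp del: real_vec_simps)
    then show ?thesis by simp
  qed
  ultimately show ?thesis by blast
qed

text \<open>The half-open cube is squeezed between the open and the closed box, both of volume
  1.\<close>

lemma lmeasurable_unit_cube: "(unit_cube :: (real ^ 'd::finite) set) \<in> lmeasurable"
  and measure_unit_cube: "measure lebesgue (unit_cube :: (real ^ 'd) set) = 1"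
proof -
  have sub: "unit_cube \<subseteq> cbox 0 (1 :: real ^ 'd)" "box 0 (1 :: real ^ 'd) \<subseteq> unit_cube"
    by (auto simp: unit_cube_def mem_box_cart less_imp_le)
  have "(unit_cube :: (real ^ 'd) set) = {x. \<forall>i\<in>UNIV. 0 \<le> x $ i \<and> x $ i < 1}"
    by (simp add: unit_cube_def)
  also have "\<dots> \<in> sets borel" by measurable
  finally have "(unit_cube :: (real ^ 'd) set) \<in> sets lebesgue" by simp
  then show lm: "(unit_cube :: (real ^ 'd) set) \<in> lmeasurable"
    using bounded_subset[OF bounded_cbox sub(1)] bounded_set_imp_lmeasurable by blast
  have one: "measure lebesgue (cbox 0 (1 :: real ^ 'd)) = 1"
    by (simp add: content_cbox_cart interval_ne_empty_cart)
  have one': "measure lebesgue (box 0 (1 :: real ^ 'd)) = 1"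
    using one by (simp add: measure_lborel_box_eq measure_lborel_cbox_eq)
  have "measure lebesgue (unit_cube :: (real ^ 'd) set) \<le> 1"
    using measure_mono_fmeasurable[OF sub(1), of lebesgue] lm one by auto
  moreover have "1 \<le> measure lebesgue (unit_cube :: (real ^ 'd) set)"
    using measure_mono_fmeasurable[OF sub(2), of lebesgue] lm one' by (auto simp: fmeasurableD)
  ultimately show "measure lebesgue (unit_cube :: (real ^ 'd) set) = 1" by simp
qed

text \<open>Cut \<open>P\<close> according to the shift that carries a point into \<open>Q\<close>;
  the shifted pieces reassemble to \<open>Q\<close>. The opposite signs in the two assumptions let
  the piece \<open>U i\<close> of \<open>P\<close> and the piece \<open>V i\<close> of
  \<open>Q\<close> share one index.\<close>

lemma emeasure_fundamental_domains_eq: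
  fixes \<tau> :: "'i::countable \<Rightarrow> 'a::euclidean_space"
  assumes P: "P \<in> sets lebesgue" and Q: "Q \<in> sets lebesgue"
    and exP: "\<And>x. \<exists>!i. x - \<tau> i \<in> P" and exQ: "\<And>x. \<exists>!i. x + \<tau> i \<in> Q"
  shows "emeasure lebesgue P = emeasure lebesgue Q"
proof -
  define U where "U = (\<lambda>i. P \<inter> (+) (- \<tau> i) ` Q)"
  define V where "V = (\<lambda>i. Q \<inter> (+) (\<tau> i) ` P)"
  have mem: "x \<in> (+) (- \<tau> i) ` Q \<longleftrightarrow> x + \<tau> i \<in> Q" "x \<in> (+) (\<tau> i) ` P \<longleftrightarrow> x - \<tau> i \<in> P" for x i
    by (force simp: image_iff algebra_simps)+
  have U: "x \<in> U i \<longleftrightarrow> x \<in> P \<and> x + \<tau> i \<in> Q" and V: "x \<in> V i \<longleftrightarrow> x \<in> Q \<and> x - \<tau> i \<in> P" for x i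
    by (simp_all only: U_def V_def Int_iff mem)
  have sets: "U i \<in> sets lebesgue" "V i \<in> sets lebesgue" for i
    unfolding U_def V_def using P Q lebesgue_sets_translation[OF Q, of "- \<tau> i"]
      lebesgue_sets_translation[OF P, of "\<tau> i"] by (blast intro: sets.Int)+
  have "V i = (+) (\<tau> i) ` U i" for i
    by (auto simp: U V image_iff Bex_def algebra_simps intro!: exI[of _ "_ - \<tau> i"])
  then have eq: "emeasure lebesgue (V i) = emeasure lebesgue (U i)" for i
    using emeasure_lebesgue_affine[of 1 "\<tau> i" "U i"] by (simp add: add.commute image_def)
  have "P = \<Union>(range U)" "Q = \<Union>(range V)"
    using ex1_implies_ex[OF exP] ex1_implies_ex[OF exQ] by (auto simp: U V set_eq_iff)
  moreover have "i = j" if "x \<in> U i" "x \<in> U j" for i j x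
    using that exQ[of x] by (auto simp: U)
  then have "disjoint_family U" by (auto simp: disjoint_family_on_def)
  moreover have "i = j" if "x \<in> V i" "x \<in> V j" for i j x
    using that exP[of x] by (auto simp: V)
  then have "disjoint_family V" by (auto simp: disjoint_family_on_def)
  ultimately show ?thesis
    using emeasure_UN_countable[of UNIV U lebesgue] emeasure_UN_countable[of UNIV V lebesgue] sets
    by (simp add: eq)
qed

text \<open>With A the transpose of M, \<open>P\<close> is a basic parallelepiped of A Z^d and has
  volume |det M|. \<open>R\<close> consists of one unit cube for each coset of A Z^d in Z^d, placed
  at the representative \<open>\<kappa> \<omega>\<close> = A \<omega>. Both are fundamental domains
  of A Z^d.\<close>

lemma card_Omega:
  fixes M :: "int ^ 'd::finite ^ 'd"
  assumes M: "det M \<noteq> 0"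
  shows "real (card (\<Omega> M)) = \<bar>real_of_int (det M)\<bar>"
proof -
  let ?A = "transpose (real_mat M)" and ?Q = "unit_cube :: (real ^ 'd) set"
  have inv: "invertible ?A" using M by (simp add: invertible_det_nz det_real_mat)
  have A_int: "?A *v real_vec m = real_vec (transpose M *v m)" for m
    by (metis real_vec_matrix_vector_mult transpose_real_mat)
  define P where "P = (*v) ?A ` ?Q"
  have P: "P \<in> lmeasurable" "measure lebesgue P = \<bar>real_of_int (det M)\<bar>"
    unfolding P_def using measure_matrix_image[OF lmeasurable_unit_cube, of ?A]
    by (simp_all add: measure_unit_cube det_real_mat del: transpose_matrix_vector)
  have "\<exists>k. ?A *v \<omega> = real_vec k" if "\<omega> \<in> \<Omega> M" for \<omega>
    using that Omega_eq[OF M] by auto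
  then obtain \<kappa> where \<kappa>: "\<And>\<omega>. \<omega> \<in> \<Omega> M \<Longrightarrow> ?A *v \<omega> = real_vec (\<kappa> \<omega>)" by metis
  define R where "R = (\<Union>\<omega>\<in>\<Omega> M. (+) (real_vec (\<kappa> \<omega>)) ` ?Q)"
  have memQ: "x \<in> (+) a ` ?Q \<longleftrightarrow> x - a \<in> ?Q" for x a
    by (force simp: image_iff algebra_simps)
  have R_iff: "x \<in> R \<longleftrightarrow> (\<exists>\<omega>\<in>\<Omega> M. x - real_vec (\<kappa> \<omega>) \<in> ?Q)" for x
    by (simp add: R_def memQ)
  have inj: "\<omega> = \<omega>'" if "\<omega> \<in> \<Omega> M" "\<omega>' \<in> \<Omega> M" "\<kappa> \<omega> = \<kappa> \<omega>'" for \<omega> \<omega>'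
    using \<kappa>[OF that(1)] \<kappa>[OF that(2)] that(3) by (metis matrix_inv_vector_mult(2)[OF inv])
  have R: "emeasure lebesgue R = of_nat (card (\<Omega> M))" and R_sets: "R \<in> sets lebesgue"
  proof -
    have meas: "(+) a ` ?Q \<in> sets lebesgue" for a
      using lmeasurable_unit_cube by (intro lebesgue_sets_translation) auto
    then show "R \<in> sets lebesgue" unfolding R_def using finite_Omega[OF M] by blast
    have "disjoint_family_on (\<lambda>\<omega>. (+) (real_vec (\<kappa> \<omega>)) ` ?Q) (\<Omega> M)"
    proof (unfold disjoint_family_on_def, intro ballI impI equals0I)
      fix \<omega> \<omega>' x
      assume *: "\<omega> \<in> \<Omega> M" "\<omega>' \<in> \<Omega> M" "\<omega> \<noteq> \<omega>'"
        "x \<in> (+) (real_vec (\<kappa> \<omega>)) ` ?Q \<inter> (+) (real_vec (\<kappa> \<omega>')) ` ?Q"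
      then have "\<kappa> \<omega> = \<kappa> \<omega>'" using unit_cube_cong[of x] by (auto simp: memQ)
      then show False using inj * by blast
    qed
    then have "emeasure lebesgue R = (\<Sum>\<omega>\<in>\<Omega> M. emeasure lebesgue ((+) (real_vec (\<kappa> \<omega>)) ` ?Q))"
      unfolding R_def using meas finite_Omega[OF M] by (intro sum_emeasure[symmetric]) auto
    also have "\<dots> = (\<Sum>\<omega>\<in>\<Omega> M. 1)"
    proof (rule sum.cong[OF refl])
      fix \<omega>
      have "(+) (real_vec (\<kappa> \<omega>)) ` ?Q \<in> lmeasurable"
        using lmeasurable_unit_cube by (rule measurable_translation)
      then show "emeasure lebesgue ((+) (real_vec (\<kappa> \<omega>)) ` ?Q) = 1"
        by (simp add: emeasure_eq_measure2 measure_translation measure_unit_cube)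
    qed
    finally show "emeasure lebesgue R = of_nat (card (\<Omega> M))" by simp
  qed
  have "emeasure lebesgue P = emeasure lebesgue R"
  proof (rule emeasure_fundamental_domains_eq[where \<tau> = "\<lambda>m. ?A *v real_vec m"])
    show "P \<in> sets lebesgue" using P(1) by auto
    show "\<exists>!m. x - ?A *v real_vec m \<in> P" for x
    proof -
      have "x - ?A *v real_vec m \<in> P \<longleftrightarrow> matrix_inv ?A *v x - real_vec m \<in> ?Q" for m
      proof -
        have "x - ?A *v real_vec m = ?A *v (matrix_inv ?A *v x - real_vec m)"
          by (simp only: matrix_vector_mult_diff_distrib matrix_inv_vector_mult(1)[OF inv])
        then show ?thesis
          unfolding P_def by (metis (no_types, lifting) imageE imageI matrix_inv_vector_mult(2)[OF inv])
      qed
      then show ?thesis using unit_cube_cong by simp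
    qed
    show "\<exists>!m. x + ?A *v real_vec m \<in> R" for x
    proof -
      \<comment> \<open>The integer cube containing \<open>x\<close> has corner \<open>j\<close>, so
        a shift of \<open>x\<close> by A m lands in \<open>R\<close> exactly when j + A m is one of
        the chosen representatives.\<close>
      obtain j where j: "x - real_vec j \<in> ?Q" using unit_cube_cong by blast
      have eq: "x + ?A *v real_vec m \<in> R \<longleftrightarrow> (\<exists>\<omega>\<in>\<Omega> M. j + transpose M *v m = \<kappa> \<omega>)" for m
      proof -
        have "x + ?A *v real_vec m - real_vec (\<kappa> \<omega>) \<in> ?Q \<longleftrightarrow> j + transpose M *v m = \<kappa> \<omega>" for \<omega>
        proof -
          have "x + ?A *v real_vec m - real_vec (\<kappa> \<omega>) = x - real_vec (\<kappa> \<omega> - transpose M *v m)"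
            unfolding A_int real_vec_simps by (simp add: algebra_simps)
          then have "x + ?A *v real_vec m - real_vec (\<kappa> \<omega>) \<in> ?Q \<longleftrightarrow> \<kappa> \<omega> - transpose M *v m = j"
            using j unit_cube_cong[of x] by (simp only:) blast
          then show ?thesis by (auto simp: algebra_simps)
        qed
        then show ?thesis by (simp only: R_iff)
      qed
      \<comment> \<open>Applying the inverse of A turns the question into which integer translate of
        \<open>y\<close> lies in the unit cube.\<close>
      define y where "y = matrix_inv ?A *v real_vec j"
      have y: "?A *v y = real_vec j" by (simp only: y_def matrix_inv_vector_mult(1)[OF inv])
      have \<kappa>_iff: "j + transpose M *v m = \<kappa> \<omega> \<longleftrightarrow> y + real_vec m = \<omega>" if "\<omega> \<in> \<Omega> M" for m \<omega>
      proof -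
        have "j + transpose M *v m = \<kappa> \<omega> \<longleftrightarrow> ?A *v (y + real_vec m) = ?A *v \<omega>"
          by (simp only: matrix_vector_right_distrib y A_int \<kappa>[OF that] real_vec_eq_iff flip: real_vec_simps(2))
        also have "\<dots> \<longleftrightarrow> y + real_vec m = \<omega>" by (metis matrix_inv_vector_mult(2)[OF inv])
        finally show ?thesis .
      qed
      have "(\<exists>\<omega>\<in>\<Omega> M. j + transpose M *v m = \<kappa> \<omega>) \<longleftrightarrow> y - real_vec (- m) \<in> ?Q" for m
      proof -
        have "?A *v (y + real_vec m) \<in> range real_vec"
          by (simp only: matrix_vector_right_distrib y A_int flip: real_vec_simps(2)) (rule rangeI)
        then have "y + real_vec m \<in> \<Omega> M \<longleftrightarrow> y + real_vec m \<in> ?Q" using Omega_eq[OF M] by auto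
        then show ?thesis using \<kappa>_iff by auto
      qed
      moreover have "\<exists>!m. y - real_vec (- m) \<in> ?Q"
        using unit_cube_cong[of y] by (metis minus_minus)
      ultimately show ?thesis by (simp only: eq)
    qed
  qed (rule R_sets)
  then have "ennreal (measure lebesgue P) = ennreal (real (card (\<Omega> M)))"
    using P(1) R by (simp add: emeasure_eq_measure2 ennreal_of_nat_eq_real_of_nat)
  then show ?thesis using P(2) by simp
qed

lemma card_Omega_Int_pos: "det M \<noteq> 0 \<Longrightarrow> det N \<noteq> 0 \<Longrightarrow> card (\<Omega> M \<inter> \<Omega> N) > 0"
  using zero_in_Omega finite_Omega by (auto simp: card_gt_0_iff)

section \<open>Uniqueness of the coefficients of a trigonometric polynomial\<close>

lemma AE_trig_poly_eq_0_imp: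
  fixes a :: "int ^ 'd::finite \<Rightarrow> complex"
  assumes T: "finite T" and ae: "AE \<xi> in lborel. (\<Sum>t\<in>T. a t * cis (- (real_vec t \<bullet> \<xi>))) = 0"
    and t0: "t0 \<in> T"
  shows "a t0 = 0"
proof -
  let ?f = "\<lambda>\<xi>. \<Sum>t\<in>T. a t * cis (- (real_vec t \<bullet> \<xi>))"
  \<comment> \<open>The zero set is closed and has full measure, hence is everything.\<close>
  have zero: "?f \<xi> = 0" for \<xi>
  proof -
    have "closed {\<xi>. ?f \<xi> = 0}"
      by (intro closed_Collect_eq continuous_intros)
    moreover have "AE \<xi> in lebesgue. \<xi> \<in> {\<xi>. ?f \<xi> = 0}"
      using AE_completion[OF ae] by simp
    ultimately have "\<xi> \<in> {\<xi>. ?f \<xi> = 0}" by (rule mem_closed_if_AE_lebesgue)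
    then show ?thesis by simp
  qed
  \<comment> \<open>Larger than every coordinate of every difference \<open>t0 - t\<close>, so that
    no other frequency in \<open>T\<close> is congruent to \<open>t0\<close> modulo D.\<close>
  define D where "D = 1 + (\<Sum>t\<in>T. \<Sum>i\<in>UNIV. \<bar>t0 $ i - t $ i\<bar>)"
  have D: "D > 0" unfolding D_def by (smt (verit) abs_ge_zero sum_nonneg)
  let ?E = "\<Omega> (mat D :: int ^ 'd ^ 'd)"
  have det: "det (mat D :: int ^ 'd ^ 'd) \<noteq> 0" using D by simp
  have lattice: "t0 - t \<in> range ((*v) (mat D)) \<longleftrightarrow> t = t0" if "t \<in> T" for t
  proof
    assume "t0 - t \<in> range ((*v) (mat D))"
    then obtain k where k: "t0 - t = mat D *v k" by blast
    have "t $ i = t0 $ i" for i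
    proof -
      have eq: "t0 $ i - t $ i = D * k $ i" using arg_cong[OF k, of "\<lambda>v. v $ i"] by simp
      have "\<bar>t0 $ i - t $ i\<bar> \<le> (\<Sum>i\<in>UNIV. \<bar>t0 $ i - t $ i\<bar>)"
        by (rule member_le_sum) auto
      also have "\<dots> \<le> (\<Sum>t\<in>T. \<Sum>i\<in>UNIV. \<bar>t0 $ i - t $ i\<bar>)"
        by (rule member_le_sum[OF that]) (auto intro: sum_nonneg T)
      finally have "\<bar>t0 $ i - t $ i\<bar> < D" by (simp add: D_def)
      then have "D * \<bar>k $ i\<bar> < D * 1" using D by (simp add: eq abs_mult)
      then have "k $ i = 0" using D by (simp add: mult_less_cancel_left)
      with eq show ?thesis by simp
    qed
    then show "t = t0" by (simp add: vec_eq_iff)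
  qed (use rangeI[of "(*v) (mat D)" 0] in simp)
  \<comment> \<open>Discrete Fourier inversion: sample at the points 2 pi \<omega> and multiply by
    the character of \<open>t0\<close>.\<close>
  have "0 = (\<Sum>\<omega>\<in>?E. character \<omega> t0 * ?f ((2 * pi) *\<^sub>R \<omega>))"
    unfolding zero by simp
  also have "\<dots> = (\<Sum>\<omega>\<in>?E. \<Sum>t\<in>T. a t * character \<omega> (t0 - t))"
  proof (intro sum.cong refl)
    fix \<omega> :: "real ^ 'd"
    have "cis (- (real_vec t \<bullet> ((2 * pi) *\<^sub>R \<omega>))) = character \<omega> (- t)" for t
      by (simp add: character_def inner_commute)
    then show "character \<omega> t0 * ?f ((2 * pi) *\<^sub>R \<omega>) = (\<Sum>t\<in>T. a t * character \<omega> (t0 - t))"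
      unfolding diff_conv_add_uminus character_add(2) by (simp add: sum_distrib_left mult_ac)
  qed
  also have "\<dots> = (\<Sum>t\<in>T. a t * (\<Sum>\<omega>\<in>?E. character \<omega> (t0 - t)))"
    by (subst sum.swap) (simp add: sum_distrib_left)
  also have "\<dots> = (\<Sum>t\<in>T. if t = t0 then a t * of_nat (card ?E) else 0)"
    using lattice by (intro sum.cong refl) (simp add: sum_character_Omega[OF det])
  also have "\<dots> = a t0 * of_nat (card ?E)" using T t0 by simp
  finally show ?thesis
    using card_Omega_Int_pos[OF det det] by simp
qed

section \<open>Scalar filters\<close>

text \<open>The set \<open>F\<close> is meant to contain the supports of all filters at once, so
  that every Fourier series becomes a sum over one finite set.\<close>

definition trig_poly :: "(int ^ 'd::finite) set \<Rightarrow> (int ^ 'd \<Rightarrow> complex) \<Rightarrow> real ^ 'd \<Rightarrow> complex" where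
  "trig_poly F f \<xi> = (\<Sum>x\<in>F. f x * cis (- (real_vec x \<bullet> \<xi>)))"

text \<open>These are the Fourier coefficients of the product in \<open>cnj_trig_poly_mult\<close>.
  The point \<open>x + t\<close> may leave \<open>F\<close>; in the applications \<open>g\<close>
  vanishes there.\<close>

definition correlation :: "(int ^ 'd::finite) set \<Rightarrow> (int ^ 'd \<Rightarrow> complex) \<Rightarrow> (int ^ 'd \<Rightarrow> complex) \<Rightarrow> int ^ 'd \<Rightarrow> complex" where
  "correlation F f g t = (\<Sum>x\<in>F. cnj (f x) * g (x + t))"

text \<open>Inserting 0 secures the index of the constant coefficient even for empty
  \<open>F\<close>.\<close>

definition differences :: "'a::group_add set \<Rightarrow> 'a set" where
  "differences F = insert 0 ((\<lambda>(x, y). y - x) ` (F \<times> F))"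

lemma finite_differences [simp]: "finite F \<Longrightarrow> finite (differences F)"
  by (simp add: differences_def)

lemma zero_in_differences [simp]: "0 \<in> differences F"
  by (simp add: differences_def)

text \<open>Substitute y = x + t; values of \<open>t\<close> that push \<open>x\<close> out of
  \<open>F\<close> contribute 0.\<close>

lemma sum_regroup_differences:
  fixes F :: "'a::ab_group_add set"
  assumes "finite F" and zero: "\<And>x y. x \<in> F \<Longrightarrow> y \<notin> F \<Longrightarrow> h x y = 0"
  shows "(\<Sum>x\<in>F. \<Sum>y\<in>F. h x y) = (\<Sum>t\<in>differences F. \<Sum>x\<in>F. h x (x + t))"
proof -
  have "(\<Sum>y\<in>F. h x y) = (\<Sum>t\<in>differences F. h x (x + t))" if x: "x \<in> F" for x
  proof -
    have "(\<Sum>t\<in>differences F. h x (x + t)) = (\<Sum>t\<in>(\<lambda>y. y - x) ` F. h x (x + t))"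
    proof (rule sum.mono_neutral_right)
      show "\<forall>t\<in>differences F - (\<lambda>y. y - x) ` F. h x (x + t) = 0"
        using zero[OF x] by (force simp: image_iff)
    qed (use assms x in \<open>auto simp: differences_def\<close>)
    also have "\<dots> = (\<Sum>y\<in>F. h x y)"
      by (subst sum.reindex) (auto simp: inj_on_def)
    finally show ?thesis ..
  qed
  then show ?thesis by (subst sum.swap) simp
qed

lemma correlation_eq_0:
  assumes "\<And>x. g x \<noteq> 0 \<Longrightarrow> x \<in> F" "t \<notin> differences F"
  shows "correlation F f g t = 0"
  unfolding correlation_def
proof (intro sum.neutral ballI)
  fix x assume "x \<in> F"
  then have "x + t \<notin> F"
    using assms(2) by (force simp: differences_def image_iff)
  then show "cnj (f x) * g (x + t) = 0" using assms(1) by auto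
qed

lemma cnj_trig_poly_mult:
  assumes "finite F" "\<And>x. g x \<noteq> 0 \<Longrightarrow> x \<in> F"
  shows "cnj (trig_poly F f \<xi>) * trig_poly F g \<xi> =
    (\<Sum>t\<in>differences F. correlation F f g t * cis (- (real_vec t \<bullet> \<xi>)))"
proof -
  have "cnj (trig_poly F f \<xi>) * trig_poly F g \<xi> =
      (\<Sum>x\<in>F. \<Sum>y\<in>F. cnj (f x) * g y * cis (- (real_vec (y - x) \<bullet> \<xi>)))"
    unfolding trig_poly_def cnj_sum sum_product
    by (intro sum.cong) (simp_all add: cis_cnj inner_diff_left cis_mult mult_ac)
  also have "\<dots> = (\<Sum>t\<in>differences F. \<Sum>x\<in>F. cnj (f x) * g (x + t) * cis (- (real_vec (x + t - x) \<bullet> \<xi>)))"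
    using assms by (intro sum_regroup_differences) auto
  also have "\<dots> = (\<Sum>t\<in>differences F. correlation F f g t * cis (- (real_vec t \<bullet> \<xi>)))"
    by (simp add: correlation_def sum_distrib_right)
  finally show ?thesis .
qed

lemma cis_inner_shift:
  "cis (- (real_vec x \<bullet> (\<xi> + (2 * pi) *\<^sub>R \<omega>))) = cis (- (real_vec x \<bullet> \<xi>)) * cnj (character \<omega> x)"
  by (simp add: character_def inner_right_distrib cis_mult cis_cnj inner_commute)

lemma trig_poly_shift:
  "trig_poly F f (\<xi> + (2 * pi) *\<^sub>R \<omega>) = trig_poly F (\<lambda>x. f x * cnj (character \<omega> x)) \<xi>"
  unfolding trig_poly_def cis_inner_shift by (simp add: mult_ac)

lemma AE_trig_poly_eq_const_iff:
  assumes "finite T" "0 \<in> T"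
  shows "(AE \<xi> in lborel. (\<Sum>t\<in>T. a t * cis (- (real_vec t \<bullet> \<xi>))) = c) \<longleftrightarrow>
    (\<forall>t\<in>T. a t = (if t = 0 then c else 0))"
proof
  have c: "(\<Sum>t\<in>T. (if t = 0 then c else 0) * cis (- (real_vec t \<bullet> \<xi>))) = c" for \<xi>
  proof -
    have "(\<Sum>t\<in>T. (if t = 0 then c else 0) * cis (- (real_vec t \<bullet> \<xi>))) = (\<Sum>t\<in>T. if t = 0 then c else 0)"
      by (intro sum.cong) auto
    then show ?thesis using assms by simp
  qed
  {
    assume "AE \<xi> in lborel. (\<Sum>t\<in>T. a t * cis (- (real_vec t \<bullet> \<xi>))) = c"
    then have "AE \<xi> in lborel. (\<Sum>t\<in>T. (a t - (if t = 0 then c else 0)) * cis (- (real_vec t \<bullet> \<xi>))) = 0"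
      unfolding left_diff_distrib sum_subtractf c by simp
    from AE_trig_poly_eq_0_imp[OF assms(1) this] show "\<forall>t\<in>T. a t = (if t = 0 then c else 0)"
      by fastforce
  }
  show "AE \<xi> in lborel. (\<Sum>t\<in>T. a t * cis (- (real_vec t \<bullet> \<xi>))) = c"
    if "\<forall>t\<in>T. a t = (if t = 0 then c else 0)"
  proof (intro always_eventually allI)
    fix \<xi>
    have "(\<Sum>t\<in>T. a t * cis (- (real_vec t \<bullet> \<xi>))) = (\<Sum>t\<in>T. (if t = 0 then c else 0) * cis (- (real_vec t \<bullet> \<xi>)))"
      using that by (intro sum.cong) auto
    then show "(\<Sum>t\<in>T. a t * cis (- (real_vec t \<bullet> \<xi>))) = c" by (simp only: c)
  qed
qed

text \<open>All filters are split into scalar-valued rows: an index \<open>j\<close> of the locale stands for a row of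
  \<open>b\<^sub>0\<close> or for one of \<open>b\<^sub>1, \<dots>, b\<^sub>s\<close>, which puts \<open>b\<^sub>0\<close> on the same footing as the others.\<close>

locale scalar_filter_bank =
  fixes MM :: "'j::finite \<Rightarrow> int ^ 'd::finite ^ 'd" and F :: "(int ^ 'd) set"
    and B C :: "'j \<Rightarrow> 'r::finite \<Rightarrow> int ^ 'd \<Rightarrow> complex"
  assumes det: "\<And>j. det (MM j) \<noteq> 0" and finite_F: "finite F"
    and support_C: "\<And>j p x. C j p x \<noteq> 0 \<Longrightarrow> x \<in> F"
begin

definition scale :: "'j \<Rightarrow> complex" where
  "scale j = of_real (sqrt \<bar>of_int (det (MM j))\<bar>)"

text \<open>This is \<open>transition\<close> after the substitution k = x + M n, which makes the
  sum range over \<open>F\<close>.\<close>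

definition W :: "(int ^ 'd \<Rightarrow> 'r \<Rightarrow> complex) \<Rightarrow> int ^ 'd \<Rightarrow> 'j \<Rightarrow> complex" where
  "W v n j = scale j * (\<Sum>p\<in>UNIV. \<Sum>x\<in>F. v (x + MM j *v n) p * cnj (B j p x))"

definition V :: "(int ^ 'd \<Rightarrow> 'j \<Rightarrow> complex) \<Rightarrow> int ^ 'd \<Rightarrow> 'r \<Rightarrow> complex" where
  "V w n p = (\<Sum>j\<in>UNIV. scale j * (\<Sum>k | n - MM j *v k \<in> F. w k j * C j p (n - MM j *v k)))"

definition G :: "'j \<Rightarrow> 'j \<Rightarrow> int ^ 'd \<Rightarrow> complex" where
  "G i j t = (\<Sum>p\<in>UNIV. correlation F (B i p) (C j p) t)"

definition cross :: "'j \<Rightarrow> 'j \<Rightarrow> real ^ 'd \<Rightarrow> complex" where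
  "cross i j \<xi> = (\<Sum>\<omega>\<in>\<Omega> (MM i) \<inter> \<Omega> (MM j). \<Sum>p\<in>UNIV.
     trig_poly F (B i p) (\<xi> + (2 * pi) *\<^sub>R \<omega>) * cnj (trig_poly F (C j p) (\<xi> + (2 * pi) *\<^sub>R \<omega>)))"

text \<open>The entry (q, p) of the matrix equation, with the finitely many pairs taken out of the
  almost-everywhere quantifier.\<close>

definition dual :: bool where
  "dual \<longleftrightarrow> (\<forall>p q. AE \<xi> in lborel. \<forall>\<omega>\<in>\<Union>j. \<Omega> (MM j).
     (\<Sum>j\<in>UNIV. indicator (\<Omega> (MM j)) \<omega> * (cnj (trig_poly F (B j q) \<xi>) * trig_poly F (C j p) (\<xi> + (2 * pi) *\<^sub>R \<omega>)))
       = (if \<omega> = 0 \<and> p = q then 1 else 0))"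

lemma scale_ne_0 [simp]: "scale j \<noteq> 0"
  using det[of j] by (simp add: scale_def)

text \<open>Here the volume count enters: the determinant factors of the two operators together
  equal the number of characters averaged over.\<close>

lemma scale_square: "scale j * scale j = of_nat (card (\<Omega> (MM j)))"
proof -
  have "scale j * scale j = of_real (real (card (\<Omega> (MM j))))"
    unfolding card_Omega[OF det] scale_def by (simp flip: of_real_mult)
  then show ?thesis by simp
qed

lemma finite_translates: "finite {k. n - MM j *v k \<in> F}"
proof -
  have "inj (\<lambda>k. n - MM j *v k)"
    using int_matrix_mult_inj[OF det, of j] by (simp add: inj_def)
  then show ?thesis using finite_vimageI[OF finite_F] by (simp add: vimage_def)
qed

text \<open>Replaces the index sets depending on \<open>j\<close> by a common one, so that sums can
  be interchanged.\<close>

lemma V_eq: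
  assumes "finite K" "\<And>j k. n - MM j *v k \<in> F \<Longrightarrow> k \<in> K"
  shows "V w n p = (\<Sum>j\<in>UNIV. scale j * (\<Sum>k\<in>K. w k j * C j p (n - MM j *v k)))"
proof -
  have "(\<Sum>k | n - MM j *v k \<in> F. w k j * C j p (n - MM j *v k)) = (\<Sum>k\<in>K. w k j * C j p (n - MM j *v k))" for j
    using assms support_C by (intro sum.mono_neutral_left) auto
  then show ?thesis by (simp add: V_def)
qed

section \<open>The cross conditions and W V = id\<close>

lemma cnj_cross:
  "cnj (cross i j \<xi>) = (\<Sum>t\<in>differences F. (if \<exists>m n. t = MM i *v m - MM j *v n
     then of_nat (card (\<Omega> (MM i) \<inter> \<Omega> (MM j))) * G i j t else 0) * cis (- (real_vec t \<bullet> \<xi>)))"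
proof -
  let ?I = "\<Omega> (MM i) \<inter> \<Omega> (MM j)"
  \<comment> \<open>In \<open>cross\<close> the conjugate sits on the factor from \<open>C\<close>;
    conjugating moves it to \<open>B\<close>, where \<open>cnj_trig_poly_mult\<close> expects
    it.\<close>
  have "cnj (cross i j \<xi>) = (\<Sum>\<omega>\<in>?I. \<Sum>p\<in>UNIV.
     cnj (trig_poly F (B i p) (\<xi> + (2 * pi) *\<^sub>R \<omega>)) * trig_poly F (C j p) (\<xi> + (2 * pi) *\<^sub>R \<omega>))"
    by (simp add: cross_def)
  also have "\<dots> = (\<Sum>\<omega>\<in>?I. \<Sum>p\<in>UNIV. \<Sum>t\<in>differences F.
     correlation F (B i p) (C j p) t * cis (- (real_vec t \<bullet> (\<xi> + (2 * pi) *\<^sub>R \<omega>))))"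
    by (simp add: cnj_trig_poly_mult[OF finite_F support_C])
  also have "\<dots> = (\<Sum>\<omega>\<in>?I. \<Sum>t\<in>differences F. G i j t * cis (- (real_vec t \<bullet> \<xi>)) * cnj (character \<omega> t))"
    by (rule sum.cong[OF refl], subst sum.swap)
      (simp only: cis_inner_shift G_def sum_distrib_right mult.assoc)
  also have "\<dots> = (\<Sum>t\<in>differences F. G i j t * cis (- (real_vec t \<bullet> \<xi>)) * cnj (\<Sum>\<omega>\<in>?I. character \<omega> t))"
    by (subst sum.swap) (simp add: sum_distrib_left)
  also have "\<dots> = (\<Sum>t\<in>differences F. (if \<exists>m n. t = MM i *v m - MM j *v n
     then of_nat (card ?I) * G i j t else 0) * cis (- (real_vec t \<bullet> \<xi>)))"
    by (intro sum.cong) (auto simp: sum_character_Omega_Int[OF det det])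
  finally show ?thesis .
qed

lemma G_eq_0: "t \<notin> differences F \<Longrightarrow> G i j t = 0"
  by (simp add: G_def correlation_eq_0[OF support_C])

lemma AE_cross_iff:
  "(AE \<xi> in lborel. cross i j \<xi> = (if i = j then 1 else 0)) \<longleftrightarrow>
   (\<forall>n k. scale i * scale j * G i j (MM i *v n - MM j *v k) = (if i = j \<and> n = k then 1 else 0))"
  (is "?L \<longleftrightarrow> ?R")
proof -
  define c :: complex where "c = of_nat (card (\<Omega> (MM i) \<inter> \<Omega> (MM j)))"
  have c: "c \<noteq> 0" using card_Omega_Int_pos[OF det det, of i j] by (simp add: c_def)
  have "?L \<longleftrightarrow> (AE \<xi> in lborel. cnj (cross i j \<xi>) = (if i = j then 1 else 0))"
    by (intro arg_cong[where f = "\<lambda>P. AE \<xi> in lborel. P \<xi>"] ext) (auto simp: complex_cnj_cancel_iff)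
  also have "\<dots> \<longleftrightarrow> (\<forall>t\<in>differences F. (if \<exists>m n. t = MM i *v m - MM j *v n then c * G i j t else 0)
      = (if t = 0 then if i = j then 1 else 0 else 0))"
    unfolding cnj_cross c_def by (rule AE_trig_poly_eq_const_iff) (simp_all add: finite_F)
  \<comment> \<open>Outside \<open>differences F\<close> both sides are 0: \<open>G\<close> vanishes
    there and \<open>t\<close> is not 0.\<close>
  also have "\<dots> \<longleftrightarrow> (\<forall>t. (\<exists>m n. t = MM i *v m - MM j *v n) \<longrightarrow> c * G i j t = (if t = 0 \<and> i = j then 1 else 0))"
  proof -
    define S where "S t \<longleftrightarrow> (\<exists>m n. t = MM i *v m - MM j *v n)" for t
    have S0: "S 0" unfolding S_def by (intro exI[of _ 0]) simp
    have "(\<forall>t\<in>differences F. (if S t then c * G i j t else 0) = (if t = 0 then if i = j then 1 else 0 else 0)) \<longleftrightarrow>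
      (\<forall>t. S t \<longrightarrow> c * G i j t = (if t = 0 \<and> i = j then 1 else 0))" (is "?P \<longleftrightarrow> ?Q")
    proof
      show ?Q if ?P
      proof (intro allI impI)
        fix t assume "S t"
        show "c * G i j t = (if t = 0 \<and> i = j then 1 else 0)"
        proof (cases "t \<in> differences F")
          case True
          then show ?thesis using bspec[OF that True] \<open>S t\<close> by auto
        next
          case False
          then show ?thesis using zero_in_differences[of F] by (auto simp: G_eq_0)
        qed
      qed
      show ?P if ?Q using that S0 by auto
    qed
    then show ?thesis by (simp only: S_def)
  qed
  also have "\<dots> \<longleftrightarrow> (\<forall>n k. c * G i j (MM i *v n - MM j *v k) = (if MM i *v n - MM j *v k = 0 \<and> i = j then 1 else 0))"
    by blast
  \<comment> \<open>For \<open>i = j\<close> the constant \<open>c\<close> is exactly the square of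
    \<open>scale i\<close>. For distinct indices the prescribed value is 0, so one nonzero factor
    may replace another.\<close>
  also have "\<dots> \<longleftrightarrow> ?R"
  proof (cases "i = j")
    case True
    have "MM i *v n - MM i *v k = 0 \<longleftrightarrow> n = k" for n k
      by (simp add: inj_eq[OF int_matrix_mult_inj[OF det]])
    then show ?thesis using True by (simp add: c_def scale_square)
  next
    case False
    then show ?thesis using c by simp
  qed
  finally show ?thesis .
qed

text \<open>The kernel of W V as an infinite matrix; \<open>K\<close> covers all columns that can
  meet row (n, i).\<close>

lemma W_V:
  assumes "finite K" "(\<Union>x\<in>F. \<Union>j. {k. x + MM i *v n - MM j *v k \<in> F}) \<subseteq> K"
  shows "W (V w) n i = (\<Sum>j\<in>UNIV. \<Sum>k\<in>K. w k j * (scale i * scale j * G i j (MM i *v n - MM j *v k)))"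
proof -
  have "W (V w) n i = scale i * (\<Sum>p\<in>UNIV. \<Sum>x\<in>F.
      (\<Sum>j\<in>UNIV. scale j * (\<Sum>k\<in>K. w k j * C j p (x + MM i *v n - MM j *v k))) * cnj (B i p x))"
    unfolding W_def by (intro arg_cong2[where f = "(*)"] refl sum.cong V_eq) (use assms in auto)
  also have "\<dots> = (\<Sum>p\<in>UNIV. \<Sum>x\<in>F. \<Sum>j\<in>UNIV. \<Sum>k\<in>K.
      w k j * (scale i * scale j * (cnj (B i p x) * C j p (x + (MM i *v n - MM j *v k)))))"
    by (simp add: sum_distrib_left sum_distrib_right mult_ac add_diff_eq)
  also have "\<dots> = (\<Sum>j\<in>UNIV. \<Sum>k\<in>K. \<Sum>p\<in>UNIV. \<Sum>x\<in>F.
      w k j * (scale i * scale j * (cnj (B i p x) * C j p (x + (MM i *v n - MM j *v k)))))"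
    by (simp only: sum.swap[where A = F] sum.swap[where A = UNIV and B = K]
        sum.swap[where A = "UNIV :: 'r set" and B = "UNIV :: 'j set"])
  also have "\<dots> = (\<Sum>j\<in>UNIV. \<Sum>k\<in>K. w k j * (scale i * scale j * G i j (MM i *v n - MM j *v k)))"
    by (simp add: G_def correlation_def sum_distrib_left)
  finally show ?thesis .
qed

lemma W_V_index_set:
  obtains K where "finite K" "k0 \<in> K" "(\<Union>x\<in>F. \<Union>j. {k. x + MM i *v n - MM j *v k \<in> F}) \<subseteq> K"
proof
  let ?K = "insert k0 (\<Union>x\<in>F. \<Union>j. {k. x + MM i *v n - MM j *v k \<in> F})"
  show "finite ?K" using finite_F finite_translates by auto
qed auto

lemma W_V_id_iff:
  "(\<forall>w. W (V w) = w) \<longleftrightarrow> (\<forall>i j. AE \<xi> in lborel. cross i j \<xi> = (if i = j then 1 else 0))"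
  unfolding AE_cross_iff
proof (intro iffI allI)
  fix i j :: 'j and n k :: "int ^ 'd"
  assume id: "\<forall>w. W (V w) = w"
  obtain K where K: "finite K" "k \<in> K" "(\<Union>x\<in>F. \<Union>j. {k. x + MM i *v n - MM j *v k \<in> F}) \<subseteq> K"
    by (rule W_V_index_set)
  \<comment> \<open>A unit sequence reads off a single kernel entry.\<close>
  let ?w = "\<lambda>l m. if l = k \<and> m = j then 1 else 0 :: complex"
  have "(if i = j \<and> n = k then 1 else 0) = W (V ?w) n i" using id by auto
  also have "\<dots> = (\<Sum>m\<in>UNIV. \<Sum>l\<in>K. if l = k \<and> m = j
      then scale i * scale m * G i m (MM i *v n - MM m *v l) else 0)"
    unfolding W_V[OF K(1) K(3)] by (intro sum.cong) auto
  also have "\<dots> = (\<Sum>m\<in>UNIV. if m = j then scale i * scale j * G i j (MM i *v n - MM j *v k) else 0)"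
    using K by (intro sum.cong) auto
  finally show "scale i * scale j * G i j (MM i *v n - MM j *v k) = (if i = j \<and> n = k then 1 else 0)"
    by simp
next
  fix w
  assume *: "\<forall>i j n k. scale i * scale j * G i j (MM i *v n - MM j *v k) = (if i = j \<and> n = k then 1 else 0)"
  show "W (V w) = w"
  proof (intro ext)
    fix n i
    obtain K where K: "finite K" "n \<in> K" "(\<Union>x\<in>F. \<Union>j. {k. x + MM i *v n - MM j *v k \<in> F}) \<subseteq> K"
      by (rule W_V_index_set)
    have "W (V w) n i = (\<Sum>j\<in>UNIV. \<Sum>k\<in>K. w k j * (if i = j \<and> n = k then 1 else 0))"
      unfolding W_V[OF K(1) K(3)] using * by simp
    also have "\<dots> = (\<Sum>j\<in>UNIV. if i = j then w n j else 0)"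
      using K by (intro sum.cong refl) (auto simp: if_distrib[of "\<lambda>x. _ * x"] cong: if_cong)
    finally show "W (V w) n i = w n i" by simp
  qed
qed

section \<open>The dual framelet equations and V W = id\<close>

lemma dual_imp_coefficients:
  assumes dual and \<omega>: "\<omega> \<in> (\<Union>j. \<Omega> (MM j))" and t: "t \<in> differences F"
  shows "(\<Sum>j\<in>UNIV. indicator (\<Omega> (MM j)) \<omega> * correlation F (B j q) (\<lambda>x. C j p x * cnj (character \<omega> x)) t)
    = (if t = 0 then if \<omega> = 0 \<and> p = q then 1 else 0 else 0)"
proof -
  \<comment> \<open>For fixed \<omega> the shift is absorbed into the coefficients of
    \<open>C\<close>, leaving one trigonometric polynomial in \<xi>.\<close>
  have "(\<Sum>j\<in>UNIV. indicator (\<Omega> (MM j)) \<omega> * (cnj (trig_poly F (B j q) \<xi>) * trig_poly F (C j p) (\<xi> + (2 * pi) *\<^sub>R \<omega>)))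
    = (\<Sum>t\<in>differences F. (\<Sum>j\<in>UNIV. indicator (\<Omega> (MM j)) \<omega> *
        correlation F (B j q) (\<lambda>x. C j p x * cnj (character \<omega> x)) t) * cis (- (real_vec t \<bullet> \<xi>)))" for \<xi>
  proof -
    have "cnj (trig_poly F (B j q) \<xi>) * trig_poly F (C j p) (\<xi> + (2 * pi) *\<^sub>R \<omega>) =
      (\<Sum>t\<in>differences F. correlation F (B j q) (\<lambda>x. C j p x * cnj (character \<omega> x)) t * cis (- (real_vec t \<bullet> \<xi>)))" (is "?l j = ?r j") for j
      unfolding trig_poly_shift by (rule cnj_trig_poly_mult[OF finite_F]) (use support_C in auto)
    then have "(\<Sum>j\<in>UNIV. indicator (\<Omega> (MM j)) \<omega> * ?l j) = (\<Sum>j\<in>UNIV. indicator (\<Omega> (MM j)) \<omega> * ?r j)"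
      by (simp only:)
    also have "\<dots> = (\<Sum>t\<in>differences F. (\<Sum>j\<in>UNIV. indicator (\<Omega> (MM j)) \<omega> *
        correlation F (B j q) (\<lambda>x. C j p x * cnj (character \<omega> x)) t) * cis (- (real_vec t \<bullet> \<xi>)))"
      unfolding sum_distrib_left sum_distrib_right mult.assoc by (rule sum.swap)
    finally show ?thesis .
  qed
  moreover have "AE \<xi> in lborel. (\<Sum>j\<in>UNIV. indicator (\<Omega> (MM j)) \<omega> *
      (cnj (trig_poly F (B j q) \<xi>) * trig_poly F (C j p) (\<xi> + (2 * pi) *\<^sub>R \<omega>))) = (if \<omega> = 0 \<and> p = q then 1 else 0)"
    by (rule eventually_mono[OF assms(1)[unfolded dual_def, rule_format, of q p]]) (use \<omega> in blast)
  ultimately show ?thesis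
    using AE_trig_poly_eq_const_iff[OF finite_differences[OF finite_F] zero_in_differences] t by simp
qed

text \<open>Orthogonality of the characters turns the sum over a lattice coset into a sum over all of \<open>F\<close>.\<close>

lemma sum_translates_eq:
  "of_nat (card (\<Omega> (MM j))) * (\<Sum>k | n - MM j *v k \<in> F. f (n - MM j *v k))
    = (\<Sum>y\<in>F. f y * (\<Sum>\<omega>\<in>\<Omega> (MM j). character \<omega> (n - y)))" for f :: "int ^ 'd \<Rightarrow> complex"
proof -
  have "(\<Sum>k | n - MM j *v k \<in> F. f (n - MM j *v k)) = (\<Sum>y | y \<in> F \<and> n - y \<in> range ((*v) (MM j)). f y)"
  proof (rule sum.reindex_bij_betw)
    show "bij_betw (\<lambda>k. n - MM j *v k) {k. n - MM j *v k \<in> F} {y. y \<in> F \<and> n - y \<in> range ((*v) (MM j))}"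
      using int_matrix_mult_inj[OF det, of j] unfolding bij_betw_def inj_on_def
      by (auto simp: image_iff) (metis diff_diff_eq2 add_diff_cancel_left')
  qed
  then show ?thesis
    using finite_F by (simp add: sum_character_Omega[OF det] sum_distrib_left mult.commute if_distrib[of "\<lambda>x. _ * x"]
        sum.inter_filter cong: if_cong)
qed

text \<open>Expanding V W v at \<open>n\<close> gives shifted values \<open>v (n - t) q\<close>
  weighted by \<open>character \<omega> n\<close> times the coefficients of
  \<open>dual_imp_coefficients\<close>; only t = 0, \<omega> = 0 and q = p survive.\<close>

lemma V_W_id:
  assumes dual
  shows "V (W v) = v"
proof (intro ext)
  fix n p
  let ?U = "\<Union>j. \<Omega> (MM j)"
  have U: "finite ?U" using finite_Omega[OF det] by simp
  have "scale j * (\<Sum>k | n - MM j *v k \<in> F. W v k j * C j p (n - MM j *v k)) =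
    (\<Sum>q\<in>UNIV. \<Sum>\<omega>\<in>\<Omega> (MM j). character \<omega> n * (\<Sum>t\<in>differences F. v (n - t) q *
       correlation F (B j q) (\<lambda>x. C j p x * cnj (character \<omega> x)) t))" for j
  proof -
    \<comment> \<open>With y = n - M k the argument x + M k of \<open>v\<close> becomes n - (y - x),
      so the summand depends on \<open>k\<close> only through \<open>y\<close> and
      \<open>sum_translates_eq\<close> applies.\<close>
    let ?f = "\<lambda>y. (\<Sum>q\<in>UNIV. \<Sum>x\<in>F. v (n - (y - x)) q * cnj (B j q x)) * C j p y"
    have cancel: "n - (n - a - x) = x + a" for a x by simp
    have "scale j * (\<Sum>k | n - MM j *v k \<in> F. W v k j * C j p (n - MM j *v k)) =
      scale j * scale j * (\<Sum>k | n - MM j *v k \<in> F. ?f (n - MM j *v k))"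
      unfolding W_def mult.assoc sum_distrib_left[symmetric] cancel by simp
    also have "\<dots> = (\<Sum>y\<in>F. ?f y * (\<Sum>\<omega>\<in>\<Omega> (MM j). character \<omega> (n - y)))"
      unfolding scale_square by (rule sum_translates_eq)
    also have "\<dots> = (\<Sum>y\<in>F. \<Sum>q\<in>UNIV. \<Sum>x\<in>F. \<Sum>\<omega>\<in>\<Omega> (MM j). character \<omega> n * (v (n - (y - x)) q *
        (cnj (B j q x) * (C j p y * cnj (character \<omega> y)))))"
      unfolding diff_conv_add_uminus[of n] character_add(2) character_uminus
      by (simp add: sum_distrib_left sum_distrib_right mult_ac add_ac)
    also have "\<dots> = (\<Sum>q\<in>UNIV. \<Sum>\<omega>\<in>\<Omega> (MM j). \<Sum>x\<in>F. \<Sum>y\<in>F. character \<omega> n * (v (n - (y - x)) q *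
        (cnj (B j q x) * (C j p y * cnj (character \<omega> y)))))"
      by (subst sum.swap, intro sum.cong refl, subst sum.swap, subst (2) sum.swap, subst sum.swap, rule refl)
    also have "\<dots> = (\<Sum>q\<in>UNIV. \<Sum>\<omega>\<in>\<Omega> (MM j). \<Sum>t\<in>differences F. \<Sum>x\<in>F. character \<omega> n * (v (n - (x + t - x)) q *
        (cnj (B j q x) * (C j p (x + t) * cnj (character \<omega> (x + t))))))"
      by (intro sum.cong refl sum_regroup_differences[OF finite_F]) (use support_C in auto)
    finally show ?thesis
      by (simp add: correlation_def sum_distrib_left)
  qed
  then have "V (W v) n p = (\<Sum>j\<in>UNIV. \<Sum>q\<in>UNIV. \<Sum>\<omega>\<in>\<Omega> (MM j). character \<omega> n * (\<Sum>t\<in>differences F. v (n - t) q *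
       correlation F (B j q) (\<lambda>x. C j p x * cnj (character \<omega> x)) t))"
    by (simp add: V_def)
  \<comment> \<open>The indicator gives all \<open>j\<close> the same range of \<omega>, so that the
    sum over \<open>j\<close> can be moved innermost, as the dual equations require.\<close>
  also have "\<dots> = (\<Sum>j\<in>UNIV. \<Sum>q\<in>UNIV. \<Sum>\<omega>\<in>?U. \<Sum>t\<in>differences F. character \<omega> n * v (n - t) q * (indicator (\<Omega> (MM j)) \<omega> *
       correlation F (B j q) (\<lambda>x. C j p x * cnj (character \<omega> x)) t))"
    by (intro sum.cong refl sum.mono_neutral_cong_left[OF U]) (auto simp: sum_distrib_left mult.assoc)
  also have "\<dots> = (\<Sum>q\<in>UNIV. \<Sum>\<omega>\<in>?U. \<Sum>t\<in>differences F. character \<omega> n * v (n - t) q * (\<Sum>j\<in>UNIV. indicator (\<Omega> (MM j)) \<omega> *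
       correlation F (B j q) (\<lambda>x. C j p x * cnj (character \<omega> x)) t))"
    unfolding sum_distrib_left
    by (subst sum.swap, intro sum.cong refl, subst sum.swap, intro sum.cong refl, subst sum.swap, rule refl)
  also have "\<dots> = (\<Sum>q\<in>UNIV. \<Sum>\<omega>\<in>?U. \<Sum>t\<in>differences F. if t = 0 then if \<omega> = 0 then if q = p then v n q else 0 else 0 else 0)"
    by (intro sum.cong refl, subst dual_imp_coefficients[OF assms]) auto
  also have "\<dots> = v n p"
    using zero_in_Omega[OF det] U by (simp add: finite_F)
  finally show "V (W v) n p = v n p" .
qed

end

section \<open>Matrix-valued filters\<close>

lemma conj_transpose_nth [simp]: "conj_transpose A $ i $ j = cnj (A $ j $ i)"
  by (simp add: conj_transpose_def transpose_def)

lemma infsum_finite_support: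
  assumes "finite S" "\<And>k. k \<notin> S \<Longrightarrow> f k = 0"
  shows "(\<Sum>\<^sub>\<infinity>k. f k) = sum f S"
proof -
  have "(\<Sum>\<^sub>\<infinity>k. f k) = (\<Sum>\<^sub>\<infinity>k\<in>S. f k)"
    using assms(2) by (intro infsum_cong_neutral) auto
  then show ?thesis using assms(1) by simp
qed

lemma fourier_series_nth:
  assumes "finite F" "\<And>x. u x \<noteq> 0 \<Longrightarrow> x \<in> F"
  shows "fourier_series u \<xi> $ i $ j = trig_poly F (\<lambda>x. u x $ i $ j) \<xi>"
proof -
  have "fourier_series u \<xi> $ i $ j = (\<Sum>k\<in>F. u k $ i $ j * exp (- \<i> * complex_of_real (real_vec k \<bullet> \<xi>)))"
    unfolding fourier_series_def using assms
    by (simp, intro infsum_finite_support) (auto, metis zero_index)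
  then show ?thesis by (simp add: trig_poly_def cis_conv_exp)
qed

lemma transition_nth:
  assumes "finite F" "\<And>x. b x \<noteq> 0 \<Longrightarrow> x \<in> F"
  shows "transition b M u n $ i $ j =
    of_real (sqrt \<bar>of_int (det M)\<bar>) * (\<Sum>p\<in>UNIV. \<Sum>x\<in>F. u (x + M *v n) $ i $ p * cnj (b x $ j $ p))"
proof -
  have "(\<Sum>\<^sub>\<infinity>k. u k ** conj_transpose (b (k - M *v n))) =
    (\<Sum>k\<in>(\<lambda>x. x + M *v n) ` F. u k ** conj_transpose (b (k - M *v n)))"
  proof (rule infsum_finite_support)
    fix k assume "k \<notin> (\<lambda>x. x + M *v n) ` F"
    then have "k - M *v n \<notin> F" by (metis diff_add_cancel imageI)
    then have "b (k - M *v n) = 0" using assms(2) by blast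
    then show "u k ** conj_transpose (b (k - M *v n)) = 0"
      by (simp add: vec_eq_iff matrix_matrix_mult_def)
  qed (use assms in simp)
  also have "\<dots> = (\<Sum>x\<in>F. u (x + M *v n) ** conj_transpose (b x))"
    by (subst sum.reindex) (auto simp: inj_on_def)
  finally have "transition b M u n $ i $ j = of_real (sqrt \<bar>of_int (det M)\<bar>) *
      (\<Sum>x\<in>F. \<Sum>p\<in>UNIV. u (x + M *v n) $ i $ p * cnj (b x $ j $ p))"
    by (simp add: transition_def scaleR_conv_of_real[where 'a = complex] matrix_matrix_mult_def)
  then show ?thesis by (subst (asm) sum.swap)
qed

lemma subdivision_nth:
  assumes M: "det M \<noteq> 0" and "finite F" "\<And>x. a x \<noteq> 0 \<Longrightarrow> x \<in> F"
  shows "subdivision a M u n $ i $ j =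
    of_real (sqrt \<bar>of_int (det M)\<bar>) * (\<Sum>k | n - M *v k \<in> F. \<Sum>p\<in>UNIV. u k $ i $ p * a (n - M *v k) $ p $ j)"
proof -
  have "inj (\<lambda>k. n - M *v k)"
    using int_matrix_mult_inj[OF M] by (simp add: inj_def)
  then have "finite {k. n - M *v k \<in> F}"
    using finite_vimageI[OF assms(2)] by (simp add: vimage_def)
  moreover have "u k ** a (n - M *v k) = 0" if "k \<notin> {k. n - M *v k \<in> F}" for k
  proof -
    have "a (n - M *v k) = 0" using that assms(3) by blast
    then show ?thesis by (simp add: vec_eq_iff matrix_matrix_mult_def)
  qed
  ultimately have "(\<Sum>\<^sub>\<infinity>k. u k ** a (n - M *v k)) = (\<Sum>k | n - M *v k \<in> F. u k ** a (n - M *v k))"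
    by (rule infsum_finite_support)
  then show ?thesis
    by (simp add: subdivision_def scaleR_conv_of_real[where 'a = complex] matrix_matrix_mult_def)
qed

lemma cross_sum_nth:
  assumes "finite F" "\<And>x. b x \<noteq> 0 \<Longrightarrow> x \<in> F" "\<And>x. c x \<noteq> 0 \<Longrightarrow> x \<in> F"
  shows "cross_sum M N b c \<xi> $ i $ j = (\<Sum>\<omega>\<in>\<Omega> M \<inter> \<Omega> N. \<Sum>p\<in>UNIV.
     trig_poly F (\<lambda>x. b x $ i $ p) (\<xi> + (2 * pi) *\<^sub>R \<omega>) * cnj (trig_poly F (\<lambda>x. c x $ j $ p) (\<xi> + (2 * pi) *\<^sub>R \<omega>)))"
  using assms by (simp add: cross_sum_def matrix_matrix_mult_def fourier_series_nth)

section \<open>Decomposition of the matrix filters into scalar rows\<close>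

definition filter_rows :: "('d, 'r::finite, 'r) mat_filter \<Rightarrow> ('s \<Rightarrow> ('d, 'r, 1) mat_filter) \<Rightarrow>
    's + 'r \<Rightarrow> 'r \<Rightarrow> int ^ 'd \<Rightarrow> complex" where
  "filter_rows b0 b j p x = (case j of Inl l \<Rightarrow> b l x $ 1 $ p | Inr m \<Rightarrow> b0 x $ m $ p)"

lemma filter_rows_simps [simp]: "filter_rows b0 b (Inl l) p = (\<lambda>x. b l x $ 1 $ p)" "filter_rows b0 b (Inr m) p = (\<lambda>x. b0 x $ m $ p)"
  by (simp_all add: filter_rows_def fun_eq_iff)

text \<open>Strips the one-element row index; this bijection carries \<open>analysis\<close> and
  \<open>synthesis\<close> to \<open>W\<close> and \<open>V\<close>.\<close>

definition entries :: "('a \<Rightarrow> 'b ^ 'c ^ 1) \<Rightarrow> 'a \<Rightarrow> 'c \<Rightarrow> 'b" where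
  "entries u k p = u k $ 1 $ p"

lemma entries_eq_iff [simp]: "entries u = entries v \<longleftrightarrow> u = v"
  by (auto simp: entries_def fun_eq_iff vec_eq_iff)

lemma surj_entries: "surj entries"
  by (rule surjI[where f = "\<lambda>g k. \<chi> i p. g k p"]) (simp add: entries_def fun_eq_iff)

lemma sum_UNIV_sum_type:
  fixes f :: "'a::finite + 'b::finite \<Rightarrow> 'c::comm_monoid_add"
  shows "(\<Sum>j\<in>UNIV. f j) = (\<Sum>m\<in>UNIV. f (Inr m)) + (\<Sum>l\<in>UNIV. f (Inl l))"
  by (simp add: UNIV_Plus_UNIV[symmetric] sum.Plus add.commute del: UNIV_Plus_UNIV)

text \<open>Since f g f = f and g f g = g, surjectivity of \<open>f\<close> cancels it on the right
  of the first identity, and injectivity of \<open>g\<close> cancels it on the left of the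
  second.\<close>

lemma left_inverse_bijective_iff:
  assumes "\<And>v. g (f v) = v"
  shows "surj f \<or> inj g \<or> (g \<circ> f = id \<and> f \<circ> g = id) \<longleftrightarrow> (\<forall>w. f (g w) = w)"
proof
  assume "\<forall>w. f (g w) = w"
  then show "surj f \<or> inj g \<or> (g \<circ> f = id \<and> f \<circ> g = id)" by (metis surjI)
next
  assume "surj f \<or> inj g \<or> (g \<circ> f = id \<and> f \<circ> g = id)"
  then show "\<forall>w. f (g w) = w"
    using assms by (elim disjE) (metis surjD, metis injD, simp add: fun_eq_iff)
qed

theorem theorem3p3:
  fixes M0 :: "int ^ 'd ^ 'd"
    and M :: "'s::finite \<Rightarrow> int ^ 'd ^ 'd"
    and b0 bt0 :: "('d::finite, 'r::finite, 'r) mat_filter"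
    and b bt :: "'s \<Rightarrow> ('d, 'r, 1) mat_filter"
  assumes "finitely_supported b0" and "finitely_supported bt0"
    and "\<And>l. finitely_supported (b l)" and "\<And>l. finitely_supported (bt l)"
    and "dilation_matrix M0" and "\<And>l. dilation_matrix (M l)"
  shows "biorthogonal_wavelet_filter_bank M0 M b0 b bt0 bt \<longleftrightarrow>
    dual_framelet_filter_bank M0 M b0 b bt0 bt \<and>
    (AE \<xi> in lborel. cross_sum M0 M0 b0 bt0 \<xi> = mat 1) \<and>
    (\<forall>k l. AE \<xi> in lborel. cross_sum (M k) (M l) (b k) (bt l) \<xi> = (if k = l then mat 1 else 0)) \<and>
    (\<forall>k. AE \<xi> in lborel. cross_sum (M k) M0 (b k) bt0 \<xi> = 0) \<and>
    (\<forall>l. AE \<xi> in lborel. cross_sum M0 (M l) b0 (bt l) \<xi> = 0)"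
proof -
  \<comment> \<open>One finite set containing the supports of all filters.\<close>
  define F where "F = {x. b0 x \<noteq> 0} \<union> {x. bt0 x \<noteq> 0} \<union> (\<Union>l. {x. b l x \<noteq> 0}) \<union> (\<Union>l. {x. bt l x \<noteq> 0})"
  have F: "finite F"
    using assms by (simp add: F_def finitely_supported_def)
  have supp: "b0 x \<noteq> 0 \<Longrightarrow> x \<in> F" "bt0 x \<noteq> 0 \<Longrightarrow> x \<in> F" "b l x \<noteq> 0 \<Longrightarrow> x \<in> F" "bt l x \<noteq> 0 \<Longrightarrow> x \<in> F" for l x
    by (auto simp: F_def)
  define MM where "MM = case_sum M (\<lambda>_ :: 'r. M0)"
  have MM [simp]: "MM (Inl l) = M l" "MM (Inr m) = M0" for l m
    by (simp_all add: MM_def)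
  have det_ne_0: "det M0 \<noteq> 0" "det (M l) \<noteq> 0" for l
    using assms by (simp_all add: dilation_matrix_imp_det_ne_0)
  interpret scalar_filter_bank MM F "filter_rows b0 b" "filter_rows bt0 bt"
  proof
    show "det (MM j) \<noteq> 0" for j using det_ne_0 by (cases j) simp_all
    show "x \<in> F" if "filter_rows bt0 bt j p x \<noteq> 0" for j p x
      using that supp by (cases j) (auto, metis zero_index, metis zero_index)
  qed (rule F)
  have dual_iff: "dual_framelet_filter_bank M0 M b0 b bt0 bt \<longleftrightarrow> dual"
  proof -
    have U: "\<Omega> M0 \<union> (\<Union>l. \<Omega> (M l)) = (\<Union>j. \<Omega> (MM j))"
      by (auto simp: MM_def split: sum.splits) (metis MM)+
    have indicator: "indicator S \<omega> *\<^sub>R z = indicator S \<omega> * z" for S and \<omega> :: "real ^ 'd" and z :: complex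
      by (simp add: indicator_def)
    have "(indicator (\<Omega> M0) \<omega> *\<^sub>R
          (conj_transpose (fourier_series b0 \<xi>) ** fourier_series bt0 (\<xi> + (2 * pi) *\<^sub>R \<omega>)) +
        (\<Sum>l\<in>UNIV. indicator (\<Omega> (M l)) \<omega> *\<^sub>R
          (conj_transpose (fourier_series (b l) \<xi>) ** fourier_series (bt l) (\<xi> + (2 * pi) *\<^sub>R \<omega>)))) $ q $ p =
      (\<Sum>j\<in>UNIV. indicator (\<Omega> (MM j)) \<omega> * (cnj (trig_poly F (filter_rows b0 b j q) \<xi>) *
        trig_poly F (filter_rows bt0 bt j p) (\<xi> + (2 * pi) *\<^sub>R \<omega>)))" (is "?X \<xi> \<omega> $ q $ p = ?S \<xi> \<omega> q p") for \<xi> \<omega> q p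
      by (simp add: sum_UNIV_sum_type matrix_matrix_mult_def fourier_series_nth[OF F] supp indicator
          sum_distrib_left)
    then have "?X \<xi> \<omega> = (if \<omega> = 0 then mat 1 else 0) \<longleftrightarrow>
      (\<forall>p q. ?S \<xi> \<omega> q p = (if \<omega> = 0 \<and> p = q then 1 else 0))" for \<xi> \<omega>
      by (subst vec_eq_iff, subst vec_eq_iff) (auto simp: mat_def)
    then have "dual_framelet_filter_bank M0 M b0 b bt0 bt \<longleftrightarrow>
      (AE \<xi> in lborel. \<forall>p q. \<forall>\<omega>\<in>\<Union>j. \<Omega> (MM j). ?S \<xi> \<omega> q p = (if \<omega> = 0 \<and> p = q then 1 else 0))"
      unfolding dual_framelet_filter_bank_def U
      by (simp only:) (intro arg_cong[where f = "\<lambda>P. AE \<xi> in lborel. P \<xi>"] ext iffI; blast)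
    then show ?thesis unfolding dual_def by (simp only: AE_all_countable)
  qed
  have W: "entries (analysis M0 M b0 b v) = W (entries v)" for v
  proof (intro ext)
    fix n j
    show "entries (analysis M0 M b0 b v) n j = W (entries v) n j"
      by (cases j) (simp_all add: entries_def analysis_def W_def scale_def transition_nth[OF F] supp)
  qed
  have V: "entries (synthesis M0 M bt0 bt w) = V (entries w)" for w
    by (intro ext) (simp add: entries_def synthesis_def V_def scale_def sum_UNIV_sum_type
        subdivision_nth[OF det_ne_0(1) F] subdivision_nth[OF det_ne_0(2) F] supp sum_distrib_left
        sum.swap[of _ "UNIV :: 'r set"])
  have cross: "(\<forall>i j. AE \<xi> in lborel. cross i j \<xi> = (if i = j then 1 else 0)) \<longleftrightarrow>
    (AE \<xi> in lborel. cross_sum M0 M0 b0 bt0 \<xi> = mat 1) \<and>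
    (\<forall>k l. AE \<xi> in lborel. cross_sum (M k) (M l) (b k) (bt l) \<xi> = (if k = l then mat 1 else 0)) \<and>
    (\<forall>k. AE \<xi> in lborel. cross_sum (M k) M0 (b k) bt0 \<xi> = 0) \<and>
    (\<forall>l. AE \<xi> in lborel. cross_sum M0 (M l) b0 (bt l) \<xi> = 0)"
  proof -
    have entry: "cross_sum M0 M0 b0 bt0 \<xi> $ m $ n = cross (Inr m) (Inr n) \<xi>"
      "cross_sum (M k) (M l) (b k) (bt l) \<xi> $ 1 $ 1 = cross (Inl k) (Inl l) \<xi>"
      "cross_sum (M k) M0 (b k) bt0 \<xi> $ 1 $ n = cross (Inl k) (Inr n) \<xi>"
      "cross_sum M0 (M l) b0 (bt l) \<xi> $ m $ 1 = cross (Inr m) (Inl l) \<xi>" for \<xi> m n k l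
      by (simp_all add: cross_def cross_sum_nth[OF F] supp)
    have eqs: "cross_sum M0 M0 b0 bt0 \<xi> = mat 1 \<longleftrightarrow> (\<forall>m n. cross (Inr m) (Inr n) \<xi> = (if m = n then 1 else 0))"
      "cross_sum (M k) (M l) (b k) (bt l) \<xi> = (if k = l then mat 1 else 0) \<longleftrightarrow>
        cross (Inl k) (Inl l) \<xi> = (if k = l then 1 else 0)"
      "cross_sum (M k) M0 (b k) bt0 \<xi> = 0 \<longleftrightarrow> (\<forall>n. cross (Inl k) (Inr n) \<xi> = 0)"
      "cross_sum M0 (M l) b0 (bt l) \<xi> = 0 \<longleftrightarrow> (\<forall>m. cross (Inr m) (Inl l) \<xi> = 0)" for \<xi> k l
      by (auto simp: vec_eq_iff entry mat_def)
    show ?thesis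
      unfolding eqs AE_all_countable by (auto simp: split_sum_all)
  qed
  \<comment> \<open>The dual framelet property is a conjunct on both sides, so the rest may be
    compared under it, where V W = id is available.\<close>
  have "dual \<Longrightarrow> (let W = analysis M0 M b0 b; V = synthesis M0 M bt0 bt
      in surj W \<or> inj V \<or> (V \<circ> W = id \<and> W \<circ> V = id)) \<longleftrightarrow>
    (\<forall>i j. AE \<xi> in lborel. cross i j \<xi> = (if i = j then 1 else 0))"
  proof -
    assume dual
    have "synthesis M0 M bt0 bt (analysis M0 M b0 b v) = v" for v
      using V_W_id[OF \<open>dual\<close>] by (simp add: V W flip: entries_eq_iff)
    then have "(let W = analysis M0 M b0 b; V = synthesis M0 M bt0 bt
      in surj W \<or> inj V \<or> (V \<circ> W = id \<and> W \<circ> V = id)) \<longleftrightarrow> (\<forall>w. W (V (entries w)) = entries w)"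
      unfolding Let_def
      by (subst left_inverse_bijective_iff) (simp_all add: V W flip: entries_eq_iff)
    also have "\<dots> \<longleftrightarrow> (\<forall>w. W (V w) = w)"
      using surj_entries by (metis surjD)
    finally show ?thesis by (simp only: W_V_id_iff)
  qed
  then show ?thesis
    unfolding biorthogonal_wavelet_filter_bank_def dual_iff cross[symmetric] by blast
qed

end
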